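(* Let $\Omega \subset \mathbb{R}^n$ be a bounded open set with smooth boundary, let $V \in C^2(\Omega)$ with $V \geq 0$, and let $\phi$ be a real-valued, not identically zero solution of $(-\Delta + V)\phi = \lambda\phi$ in $\Omega$ with Dirichlet boundary conditions. Let $h : \Omega \to \mathbb{R}$ be a measurable function such that $$ |\phi(x)| \leq h(x)\, \|\phi\|_{L^\infty} \qquad \text{for all } x \in \Omega.$$ Then $$ |\phi(x)| \leq h_1(x)\, \|\phi\|_{L^\infty} \qquad \text{for all } x \in \Omega,$$ where $$ h_1(x) = \inf_{t \geq 0} \mathbb{E}_x\left( h(\omega(t))\, e^{\lambda t - \int_0^t V(\omega(s))\,ds}\right) = \inf_{t \geq 0} e^{\lambda t}\, \bigl(e^{t(\Delta - V)} h\bigr)(x).$$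
   Context: $\|\phi\|_{L^\infty}$ is the supremum norm over $\Omega$. Solutions are understood classically: $\phi \in C^2(\Omega)\cap C(\overline{\Omega})$ with $\phi = 0$ on $\partial\Omega$. $\mathbb{E}_x$ denotes expectation with respect to Brownian motion $\omega(\cdot)$ started at $\omega(0)=x$, normalized to have generator $\Delta$ (i.e. $\omega(t) = x + \sqrt{2}\,W_t$ with $W$ a standard Brownian motion), and destroyed (killed) upon hitting $\partial\Omega$: paths that have hit $\partial\Omega$ by time $t$ contribute $0$ to the expectation. $e^{t(\Delta - V)}$ is the semigroup generated by $\Delta - V$ on $\Omega$ with Dirichlet boundary conditions, acting on functions $f$ through the Feynman–Kac formula $$ \bigl(e^{t(\Delta - V)} f\bigr)(x) = \mathbb{E}_x\left( f(\omega(t))\, e^{-\int_0^t V(\omega(s))\,ds}\right).$$ The hypothesis on $h$ forces $h \geq 0$, so the expectations above are well defined in $[0,\infty]$. *)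

theory Defs
  imports "HOL-Probability.Probability"
begin

text \<open>\<open>Ck_on k f S\<close> is only meant for open \<open>S\<close>; \<open>f\<close> and its derivatives up to
  order \<open>k\<close> need not be bounded on \<open>S\<close>.\<close>

primrec Ck_on ::
  "nat \<Rightarrow> ('a::real_normed_vector \<Rightarrow> 'b::real_normed_vector) \<Rightarrow> 'a set \<Rightarrow> bool" where
  "Ck_on 0 f S \<longleftrightarrow> continuous_on S f"
| "Ck_on (Suc k) f S \<longleftrightarrow>
     (\<forall>x\<in>S. f differentiable (at x)) \<and>
     (\<forall>v. Ck_on k (\<lambda>x. frechet_derivative f (at x) v) S)"

definition smooth_on :: "('a::real_normed_vector \<Rightarrow> 'b::real_normed_vector) \<Rightarrow> 'a set \<Rightarrow> bool" where
  "smooth_on f S \<longleftrightarrow> (\<forall>k. Ck_on k f S)"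

definition laplacian :: "(real ^ 'n \<Rightarrow> real) \<Rightarrow> real ^ 'n \<Rightarrow> real" where
  "laplacian f x =
     (\<Sum>i\<in>UNIV. frechet_derivative (\<lambda>y. frechet_derivative f (at y) (axis i 1)) (at x) (axis i 1))"

text \<open>Near each boundary point, \<open>\<Omega>\<close> is a strict sublevel set of a smooth function without
  critical points, so \<open>\<Omega>\<close> lies locally on one side of a smooth hypersurface.\<close>

definition smooth_boundary :: "(real ^ 'n) set \<Rightarrow> bool" where
  "smooth_boundary \<Omega> \<longleftrightarrow>
     (\<forall>p\<in>frontier \<Omega>. \<exists>U \<rho>. open U \<and> p \<in> U \<and> smooth_on (\<rho> :: real ^ 'n \<Rightarrow> real) U \<and>
        (\<forall>y\<in>U. \<exists>v. frechet_derivative \<rho> (at y) v \<noteq> 0) \<and>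
        \<Omega> \<inter> U = {y \<in> U. \<rho> y < 0})"

definition dirichlet_solution ::
  "(real ^ 'n) set \<Rightarrow> (real ^ 'n \<Rightarrow> real) \<Rightarrow> real \<Rightarrow> (real ^ 'n \<Rightarrow> real) \<Rightarrow> bool" where
  "dirichlet_solution \<Omega> V lam \<phi> \<longleftrightarrow>
     Ck_on 2 \<phi> \<Omega> \<and> continuous_on (closure \<Omega>) \<phi> \<and>
     (\<forall>x\<in>\<Omega>. - laplacian \<phi> x + V x * \<phi> x = lam * \<phi> x) \<and>
     (\<forall>x\<in>frontier \<Omega>. \<phi> x = 0)"

definition sup_norm :: "'a set \<Rightarrow> ('a \<Rightarrow> real) \<Rightarrow> real" where
  "sup_norm \<Omega> f = (SUP x\<in>\<Omega>. \<bar>f x\<bar>)"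

text \<open>Time is \<open>{0..}\<close>; the values of \<open>W\<close> at negative times are irrelevant.\<close>

locale standard_brownian_motion = prob_space M
  for M :: "'w measure" +
  fixes W :: "real \<Rightarrow> 'w \<Rightarrow> real ^ 'n"
  assumes measurable_W: "\<And>t. 0 \<le> t \<Longrightarrow> W t \<in> borel_measurable M"
    and start_zero: "\<And>w. w \<in> space M \<Longrightarrow> W 0 w = 0"
    and continuous_paths: "\<And>w. w \<in> space M \<Longrightarrow> continuous_on {0..} (\<lambda>t. W t w)"
    and gaussian_increments: "\<And>s t. 0 \<le> s \<Longrightarrow> s < t \<Longrightarrow>
          distributed M lborel (\<lambda>w. W t w - W s w)
            (\<lambda>y. ennreal (\<Prod>i\<in>UNIV. normal_density 0 (sqrt (t - s)) (y $ i)))"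
    and independent_increments: "\<And>(k::nat) \<tau>. 0 \<le> \<tau> 0 \<Longrightarrow> (\<And>i. i < k \<Longrightarrow> \<tau> i < \<tau> (Suc i)) \<Longrightarrow>
          indep_vars (\<lambda>_. borel) (\<lambda>i w. W (\<tau> (Suc i)) w - W (\<tau> i) w) {..<k}"

text \<open>The factor \<open>sqrt 2\<close> makes \<open>\<Delta>\<close> (rather than \<open>\<Delta>/2\<close>) the generator.\<close>

definition bm_path :: "(real \<Rightarrow> 'w \<Rightarrow> real ^ 'n) \<Rightarrow> real ^ 'n \<Rightarrow> 'w \<Rightarrow> real \<Rightarrow> real ^ 'n" where
  "bm_path W x w t = x + sqrt 2 *\<^sub>R W t w"

text \<open>For a continuous path started in an open \<open>\<Omega>\<close>, \<open>alive\<close> says that the path stays in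
  \<open>\<Omega>\<close> throughout \<open>{0..t}\<close>.\<close>

definition alive :: "(real ^ 'n) set \<Rightarrow> (real \<Rightarrow> real ^ 'n) \<Rightarrow> real \<Rightarrow> bool" where
  "alive \<Omega> \<omega> t \<longleftrightarrow> (\<forall>s\<in>{0..t}. \<omega> s \<notin> frontier \<Omega>)"

text \<open>Expectation of a nonnegative functional \<open>F\<close> of the path started at \<open>x\<close>, over the
  paths that have not been killed by time \<open>t\<close>. Negative values of \<open>F\<close> would be truncated
  to \<open>0\<close> by \<open>ennreal\<close>. If \<open>F\<close> evaluates a Lebesgue measurable function at time \<open>t > 0\<close>, the
  integrand may be measurable only for the completion of \<open>M\<close>; the integral is the same by
  \<open>nn_integral_completion\<close>.\<close>

definition killed_expectation ::
  "'w measure \<Rightarrow> (real \<Rightarrow> 'w \<Rightarrow> real ^ 'n) \<Rightarrow> (real ^ 'n) set \<Rightarrow> real \<Rightarrow> real ^ 'n \<Rightarrow>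
     ((real \<Rightarrow> real ^ 'n) \<Rightarrow> real) \<Rightarrow> ennreal" where
  "killed_expectation M W \<Omega> t x F =
     (\<integral>\<^sup>+ w. (if alive \<Omega> (bm_path W x w) t then ennreal (F (bm_path W x w)) else 0) \<partial>M)"

text \<open>The Dirichlet semigroup generated by \<open>\<Delta> - V\<close>, acting on nonnegative \<open>f\<close> through the
  Feynman--Kac formula.\<close>

definition schroedinger_semigroup ::
  "'w measure \<Rightarrow> (real \<Rightarrow> 'w \<Rightarrow> real ^ 'n) \<Rightarrow> (real ^ 'n) set \<Rightarrow> (real ^ 'n \<Rightarrow> real) \<Rightarrow>
     real \<Rightarrow> (real ^ 'n \<Rightarrow> real) \<Rightarrow> real ^ 'n \<Rightarrow> ennreal" where
  "schroedinger_semigroup M W \<Omega> V t f x =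
     killed_expectation M W \<Omega> t x
       (\<lambda>\<omega>. f (\<omega> t) * exp (- integral {0..t} (\<lambda>s. V (\<omega> s))))"

definition h1 ::
  "'w measure \<Rightarrow> (real \<Rightarrow> 'w \<Rightarrow> real ^ 'n) \<Rightarrow> (real ^ 'n) set \<Rightarrow> (real ^ 'n \<Rightarrow> real) \<Rightarrow>
     real \<Rightarrow> (real ^ 'n \<Rightarrow> real) \<Rightarrow> real ^ 'n \<Rightarrow> ennreal" where
  "h1 M W \<Omega> V lam h x =
     (INF t\<in>{0..}. killed_expectation M W \<Omega> t x
        (\<lambda>\<omega>. h (\<omega> t) * exp (lam * t - integral {0..t} (\<lambda>s. V (\<omega> s)))))"

end

theory Submission imports Defs begin

text \<open>The function \<open>\<phi>\<close> is stationary for the killed and weighted heat flow: Feynman--Kac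
  suggests
  \<open>\<bar>\<phi> x\<bar> \<le> E\<^sub>x (\<bar>\<phi> (\<omega> t)\<bar> exp (lam * t - \<integral> V (\<omega> s) ds))\<close>, the expectation being over
  paths that survive up to time \<open>t\<close>. Bounding \<open>\<bar>\<phi>\<bar>\<close> by \<open>h\<close> times its supremum under the
  expectation and taking the infimum over \<open>t\<close> gives the theorem, so the content is
  the inequality above, \<open>abs_le_killed_path_integral\<close>. The formula relating \<open>h1\<close> to the semigroup is the
  extraction of the constant \<open>exp (lam * t)\<close> from an integral.

  The inequality is proved without stochastic integration, by discretizing time. Let
  \<open>K\<close> be the compact set where \<open>\<bar>\<phi>\<bar>\<close> is at least \<open>\<epsilon>\<close>; it lies inside \<open>\<Omega>\<close> because \<open>\<phi>\<close> vanishes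
  on the boundary. On \<open>K\<close> the second derivatives of \<open>\<phi>\<close> and the potential are under uniform control,
  whatever they do near the boundary. Hence a Gaussian step of
  duration \<open>d\<close> from a point of \<open>K\<close>, weighted by \<open>exp ((lam - V y) * d)\<close>, reproduces \<open>\<phi>\<close> up to
  an error \<open>o(d)\<close> that is uniform in \<open>y\<close>: the first-order terms cancel by the eigenvalue
  equation (\<open>one_step_estimate\<close>). Off \<open>K\<close> the trivial bound \<open>\<epsilon>\<close> is good enough, so paths found
  outside \<open>K\<close> at a grid time can be dropped at the cost of \<open>\<epsilon>\<close>, and no information on the exit
  position is needed. Iterating over \<open>N\<close> steps of length \<open>t / N\<close> (\<open>le_weighted_step_iterate\<close>)
  yields an upper bound for \<open>\<bar>\<phi> x\<bar>\<close> which, by independence of the increments, is an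
  expectation over Brownian paths observed on the grid (\<open>nn_integral_bm_grid\<close>), plus an error
  of order \<open>\<epsilon> + o(1)\<close>.

  As the grid is refined, each path that leaves \<open>K\<close> is eventually caught by the grid, and
  along each path that stays in \<open>K\<close> the sums in the exponent converge to the integral of the
  potential (\<open>limsup_grid_weights_le\<close>). The integrands are uniformly bounded, so the reverse
  Fatou lemma gives the claim up to an arbitrarily small error.\<close>

section \<open>Scaling nonnegative integrals, and Gaussian moments\<close>

text \<open>The integral is a supremum over simple functions below the integrand, and multiplication
  by a positive real permutes these; so the function may be non-measurable. This matters because
  a Lebesgue measurable function composed with Brownian motion need not be measurable for the
  uncompleted measure.\<close>

lemma nn_integral_scale:
  fixes f :: "'a \<Rightarrow> ennreal"
  assumes "0 < c"
  shows "(\<integral>\<^sup>+ w. ennreal c * f w \<partial>M) = ennreal c * (\<integral>\<^sup>+ w. f w \<partial>M)"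
proof -
  \<comment> \<open>One inequality for all \<open>c\<close> and \<open>f\<close> suffices; the converse is the case of the factor \<open>1 / c\<close>.\<close>
  have le: "ennreal c * (\<integral>\<^sup>+ w. f w \<partial>M) \<le> (\<integral>\<^sup>+ w. ennreal c * f w \<partial>M)"
    for c and f :: "'a \<Rightarrow> ennreal"
  proof -
    have ne: "{g. simple_function M g \<and> g \<le> f} \<noteq> {}"
      by (auto intro!: exI[of _ "\<lambda>_. 0"] simp: le_fun_def)
    have "ennreal c * (\<integral>\<^sup>+ w. f w \<partial>M)
        = (SUP g\<in>{g. simple_function M g \<and> g \<le> f}. ennreal c * integral\<^sup>S M g)"
      unfolding nn_integral_def by (rule SUP_mult_left_ennreal)
    also have "\<dots> \<le> (\<integral>\<^sup>+ w. ennreal c * f w \<partial>M)"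
    proof (rule SUP_least)
      fix g assume "g \<in> {g. simple_function M g \<and> g \<le> f}"
      then have g: "simple_function M g" "\<And>w. g w \<le> f w" by (auto simp: le_fun_def)
      have "ennreal c * integral\<^sup>S M g = (\<integral>\<^sup>+ w. ennreal c * g w \<partial>M)"
        using g(1) by (simp add: nn_integral_cmult nn_integral_eq_simple_integral
            borel_measurable_simple_function)
      also have "\<dots> \<le> (\<integral>\<^sup>+ w. ennreal c * f w \<partial>M)"
        by (intro nn_integral_mono mult_left_mono g) simp
      finally show "ennreal c * integral\<^sup>S M g \<le> (\<integral>\<^sup>+ w. ennreal c * f w \<partial>M)" .
    qed
    finally show ?thesis .
  qed
  have one: "ennreal c * ennreal (1 / c) = 1" "ennreal (1 / c) * ennreal c = 1"
    using assms by (simp_all add: ennreal_mult[symmetric])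
  have "ennreal (1 / c) * (\<integral>\<^sup>+ w. ennreal c * f w \<partial>M)
      \<le> (\<integral>\<^sup>+ w. ennreal (1 / c) * (ennreal c * f w) \<partial>M)" by (rule le)
  also have "\<dots> = (\<integral>\<^sup>+ w. f w \<partial>M)"
    by (simp add: mult.assoc[symmetric] one)
  finally have "ennreal c * (ennreal (1 / c) * (\<integral>\<^sup>+ w. ennreal c * f w \<partial>M))
      \<le> ennreal c * (\<integral>\<^sup>+ w. f w \<partial>M)" by (rule mult_left_mono) simp
  then show ?thesis
    using le[of c f] by (simp add: mult.assoc[symmetric] one)
qed

text \<open>The law of a Brownian increment over a time span \<open>d\<close>, so \<open>d\<close> is the variance of each
  coordinate and not the standard deviation.\<close>

definition gauss :: "real \<Rightarrow> (real ^ 'n) measure" where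
  "gauss d = density lborel (\<lambda>y. ennreal (\<Prod>i\<in>UNIV. normal_density 0 (sqrt d) (y $ i)))"

lemma sets_gauss [measurable_cong, simp]: "sets (gauss d) = sets borel"
  by (simp add: gauss_def)

lemma space_gauss [simp]: "space (gauss d) = UNIV"
  by (simp add: gauss_def)

text \<open>Lebesgue measure on \<open>real ^ 'n\<close> is the image of a product measure indexed by the
  standard basis, so Fubini applies once the basis vectors are identified with the coordinates.\<close>

lemma has_bochner_integral_lborel_vec_prod:
  fixes g :: "'n::finite \<Rightarrow> real \<Rightarrow> real"
  assumes "\<And>i. integrable lborel (g i)"
  shows "has_bochner_integral lborel (\<lambda>y::real^'n. \<Prod>i\<in>UNIV. g i (y $ i))
     (\<Prod>i\<in>UNIV. integral\<^sup>L lborel (g i))"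
proof -
  interpret product_sigma_finite "\<lambda>_::real^'n. lborel :: real measure" ..
  define e where "e = (\<lambda>i::'n. axis i (1::real))"
  have inj: "inj e" by (auto simp: e_def inj_def axis_eq_axis)
  have B: "(Basis :: (real^'n) set) = range e"
    by (auto simp: e_def Basis_vec_def)
  define G where "G = (\<lambda>b. g (inv e b))"
  have Ge: "G (e i) = g i" for i by (simp add: G_def inv_f_f[OF inj])
  have prod_eq: "(\<Prod>b\<in>Basis. G b (F b)) = (\<Prod>i\<in>UNIV. g i (F (e i)))" for F
    unfolding B using inj by (simp add: prod.reindex Ge)
  have meas: "(\<lambda>f. \<Sum>b\<in>Basis. f b *\<^sub>R b) \<in>
      (\<Pi>\<^sub>M b\<in>Basis. lborel) \<rightarrow>\<^sub>M (borel :: (real^'n) measure)" by measurable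
  have comp: "(\<Sum>b\<in>Basis. f b *\<^sub>R b) $ i = f (e i)" for f and i :: 'n
  proof -
    have "(\<Sum>b\<in>Basis. f b *\<^sub>R b) $ i = (\<Sum>b\<in>Basis. f b *\<^sub>R b) \<bullet> e i"
      by (simp add: e_def inner_axis)
    also have "\<dots> = f (e i)" by (rule inner_sum_left_Basis) (simp add: B)
    finally show ?thesis .
  qed
  have [measurable]: "g i \<in> borel_measurable borel" for i
    using borel_measurable_integrable[OF assms[of i]] by simp
  have int: "integrable lborel (G b)" for b by (simp add: G_def assms)
  have gm: "(\<lambda>y::real^'n. \<Prod>i\<in>UNIV. g i (y $ i)) \<in> borel_measurable borel" by measurable
  have "has_bochner_integral (\<Pi>\<^sub>M b\<in>Basis. lborel) (\<lambda>f. \<Prod>b\<in>Basis. G b (f b))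
      (\<Prod>b\<in>Basis. integral\<^sup>L lborel (G b))"
    using product_integrable_prod[of Basis G] product_integral_prod[of Basis G] int
    by (simp add: has_bochner_integral_iff)
  moreover have "(\<Prod>b\<in>Basis. integral\<^sup>L lborel (G b)) = (\<Prod>i\<in>UNIV. integral\<^sup>L lborel (g i))"
    unfolding B using inj by (simp add: prod.reindex Ge)
  ultimately have "has_bochner_integral (distr (\<Pi>\<^sub>M b\<in>Basis. lborel) borel
        (\<lambda>f. \<Sum>b\<in>Basis. f b *\<^sub>R b)) (\<lambda>y::real^'n. \<Prod>i\<in>UNIV. g i (y $ i))
      (\<Prod>i\<in>UNIV. integral\<^sup>L lborel (g i))"
    by (intro has_bochner_integral_distr[OF gm meas]) (simp only: comp prod_eq)
  then show ?thesis by (simp add: lborel_eq[symmetric])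
qed

lemma has_bochner_integral_gauss_monomial:
  assumes "0 < d"
  shows "has_bochner_integral (gauss d) (\<lambda>y::real^'n. \<Prod>i\<in>UNIV. y $ i ^ p i)
     (\<Prod>i\<in>UNIV. \<integral>x. normal_density 0 (sqrt d) x * x ^ p i \<partial>lborel)"
proof -
  have "integrable lborel (\<lambda>x. normal_density 0 (sqrt d) x * x ^ p i)" for i
    using integrable_normal_moment[of "sqrt d" 0 "p i"] assms by simp
  from has_bochner_integral_lborel_vec_prod[OF this]
  have "has_bochner_integral lborel (\<lambda>y::real^'n. (\<Prod>i\<in>UNIV. normal_density 0 (sqrt d) (y $ i)) *
      (\<Prod>i\<in>UNIV. y $ i ^ p i)) (\<Prod>i\<in>UNIV. \<integral>x. normal_density 0 (sqrt d) x * x ^ p i \<partial>lborel)"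
    by (simp add: prod.distrib)
  then show ?thesis
    unfolding gauss_def
    by (intro has_bochner_integral_density) (auto intro!: prod_nonneg)
qed

text \<open>Powers of single coordinates are written as full monomials, to bring them into the form
  of \<open>has_bochner_integral_gauss_monomial\<close>.\<close>

lemma vec_power_eq_prod: "(y :: real^'n) $ i ^ k = (\<Prod>j\<in>UNIV. y $ j ^ (if j = i then k else 0))"
proof -
  have "(\<Prod>j\<in>UNIV. y $ j ^ (if j = i then k else 0)) = (\<Prod>j\<in>UNIV. if j = i then y $ j ^ k else 1)"
    by (rule prod.cong) auto
  then show ?thesis by (simp add: prod.delta)
qed

lemma normal_integral_0: "0 < d \<Longrightarrow> (\<integral>x. normal_density 0 (sqrt d) x * x ^ 0 \<partial>lborel) = 1"
  by simp

lemma normal_integral_1: "0 < d \<Longrightarrow> (\<integral>x. normal_density 0 (sqrt d) x * x ^ 1 \<partial>lborel) = 0"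
  using integral_normal_moment_nz_1[of "sqrt d" 0] by simp

lemma normal_integral_2: "0 < d \<Longrightarrow> (\<integral>x. normal_density 0 (sqrt d) x * x ^ 2 \<partial>lborel) = d"
  using integral_normal_moment_even[of "sqrt d" 0 1] by simp

lemma normal_integral_4: "0 < d \<Longrightarrow> (\<integral>x. normal_density 0 (sqrt d) x * x ^ 4 \<partial>lborel) = 3 * d\<^sup>2"
  using integral_normal_moment_even[of "sqrt d" 0 2]
  by (simp add: fact_numeral power2_eq_square field_simps)

lemma prod_if_one: "(\<Prod>j\<in>UNIV. f (if j = (i::'n::finite) then k else (0::nat)) :: real) = f k"
  if "f 0 = 1"
proof -
  have "(\<Prod>j\<in>UNIV. f (if j = i then k else 0)) = (\<Prod>j\<in>UNIV. if j = i then f k else 1)"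
    by (rule prod.cong) (auto simp: that)
  then show ?thesis by (simp add: prod.delta)
qed

lemma gauss_coord_power:
  assumes "0 < d"
  shows "has_bochner_integral (gauss d) (\<lambda>y::real^'n. y $ i ^ k)
    (\<integral>x. normal_density 0 (sqrt d) x * x ^ k \<partial>lborel)"
proof -
  have "has_bochner_integral (gauss d) (\<lambda>y::real^'n. y $ i ^ k)
    (\<Prod>j\<in>UNIV. \<integral>x. normal_density 0 (sqrt d) x * x ^ (if j = i then k else 0) \<partial>lborel)"
    unfolding vec_power_eq_prod[of _ i k]
    by (rule has_bochner_integral_gauss_monomial[OF assms])
  then show ?thesis
    using prod_if_one[of "\<lambda>k. \<integral>x. normal_density 0 (sqrt d) x * x ^ k \<partial>lborel" i k]
      normal_integral_0[OF assms] by simp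
qed

lemma gauss_mean: "0 < d \<Longrightarrow> has_bochner_integral (gauss d) (\<lambda>y::real^'n. y $ i) 0"
  using gauss_coord_power[of d i 1] normal_integral_1[of d] by simp

lemma gauss_covariance:
  assumes "0 < d"
  shows "has_bochner_integral (gauss d) (\<lambda>y::real^'n. y $ i * y $ j) (if i = j then d else 0)"
proof (cases "i = j")
  case True
  then show ?thesis
    using gauss_coord_power[OF assms, of i 2] normal_integral_2[OF assms]
    by (simp add: power2_eq_square)
next
  case False
  \<comment> \<open>For \<open>i \<noteq> j\<close> the monomial contains a factor of degree 1, whose mean is zero.\<close>
  define p where "p = (\<lambda>k. (if k = i then 1 else 0) + (if k = j then 1 else 0 :: nat))"
  have "has_bochner_integral (gauss d) (\<lambda>y::real^'n. \<Prod>k\<in>UNIV. y $ k ^ p k)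
     (\<Prod>k\<in>UNIV. \<integral>x. normal_density 0 (sqrt d) x * x ^ p k \<partial>lborel)"
    by (rule has_bochner_integral_gauss_monomial[OF assms])
  moreover have "(\<Prod>k\<in>UNIV. \<integral>x. normal_density 0 (sqrt d) x * x ^ p k \<partial>lborel) = 0"
    using False normal_integral_1[OF assms]
    by (intro prod_zero) (auto intro!: bexI[of _ i] simp: p_def)
  moreover have "(\<Prod>k\<in>UNIV. y $ k ^ p k) = y $ i * y $ j" for y :: "real^'n"
    using vec_power_eq_prod[of y i 1] vec_power_eq_prod[of y j 1]
    by (simp add: p_def power_add prod.distrib)
  ultimately show ?thesis using False by simp
qed

lemma prob_space_gauss:
  assumes "0 < d" shows "prob_space (gauss d :: (real^'n) measure)"
proof
  have "has_bochner_integral (gauss d) (\<lambda>y::real^'n. 1::real) 1"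
    using gauss_coord_power[OF assms, of undefined 0] normal_integral_0[OF assms] by simp
  then have "integral\<^sup>N (gauss d) (\<lambda>y::real^'n. ennreal 1) = ennreal 1"
    by (subst nn_integral_eq_integral) (auto simp: has_bochner_integral_iff)
  then show "emeasure (gauss d) (space (gauss d :: (real^'n) measure)) = 1" by simp
qed

lemma norm_power2_vec: "norm (y :: real^'n) ^ 2 = (\<Sum>i\<in>UNIV. y $ i ^ 2)"
  by (simp add: norm_vec_def L2_set_def sum_nonneg)

lemma gauss_norm_power2:
  assumes "0 < d"
  shows "has_bochner_integral (gauss d) (\<lambda>y::real^'n. norm y ^ 2) (real CARD('n) * d)"
proof -
  have "has_bochner_integral (gauss d) (\<lambda>y::real^'n. \<Sum>i\<in>UNIV. y $ i ^ 2) (\<Sum>i\<in>(UNIV::'n set). d)"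
    using gauss_coord_power[OF assms, of _ 2] normal_integral_2[OF assms]
    by (intro has_bochner_integral_sum) simp
  then show ?thesis by (simp add: norm_power2_vec)
qed

text \<open>Only the order \<open>d\<^sup>2\<close> matters later: it makes quartic remainders negligible over a step
  of length \<open>d\<close>.\<close>

lemma gauss_norm_power4:
  assumes "0 < d"
  shows "integrable (gauss d) (\<lambda>y::real^'n. norm y ^ 4)"
    and "(\<integral>y. norm (y::real^'n) ^ 4 \<partial>gauss d) \<le> 3 * real CARD('n) ^ 2 * d\<^sup>2"
proof -
  have bi: "has_bochner_integral (gauss d)
      (\<lambda>y::real^'n. real CARD('n) * (\<Sum>i\<in>UNIV. y $ i ^ 4))
      (real CARD('n) * (\<Sum>i\<in>(UNIV::'n set). 3 * d\<^sup>2))"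
    using gauss_coord_power[OF assms, of _ 4] normal_integral_4[OF assms]
    by (intro has_bochner_integral_mult_right has_bochner_integral_sum) simp
  have le: "norm y ^ 4 \<le> real CARD('n) * (\<Sum>i\<in>UNIV. y $ i ^ 4)" for y :: "real^'n"
  proof -
    have "norm y ^ 4 = (norm y ^ 2) ^ 2" by simp
    also have "\<dots> = (\<Sum>i\<in>UNIV. y $ i ^ 2 * 1) ^ 2" by (simp add: norm_power2_vec)
    also have "\<dots> \<le> (\<Sum>i\<in>UNIV. (y $ i ^ 2) ^ 2) * (\<Sum>i\<in>(UNIV::'n set). 1 ^ 2)"
      by (rule Cauchy_Schwarz_ineq_sum)
    finally show ?thesis by (simp add: mult.commute)
  qed
  show i: "integrable (gauss d) (\<lambda>y::real^'n. norm y ^ 4)"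
    by (rule Bochner_Integration.integrable_bound[OF integrable.intros[OF bi]])
       (auto intro!: AE_I2 order_trans[OF le])
  have "(\<integral>y. norm (y::real^'n) ^ 4 \<partial>gauss d)
      \<le> (\<integral>y. real CARD('n) * (\<Sum>i\<in>UNIV. (y::real^'n) $ i ^ 4) \<partial>gauss d)"
    by (intro integral_mono i integrable.intros[OF bi] le)
  also have "\<dots> = 3 * real CARD('n) ^ 2 * d\<^sup>2"
    using has_bochner_integral_integral_eq[OF bi] by (simp add: power2_eq_square)
  finally show "(\<integral>y. norm (y::real^'n) ^ 4 \<partial>gauss d) \<le> 3 * real CARD('n) ^ 2 * d\<^sup>2" .
qed

section \<open>A second-order Taylor bound valid for all displacements\<close>

definition partial_deriv :: "'n \<Rightarrow> (real ^ 'n \<Rightarrow> real) \<Rightarrow> real ^ 'n \<Rightarrow> real" where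
  "partial_deriv i f x = frechet_derivative f (at x) (axis i 1)"

lemma laplacian_eq_partial_derivs:
  "laplacian f x = (\<Sum>i\<in>UNIV. partial_deriv i (partial_deriv i f) x)"
  by (simp add: laplacian_def partial_deriv_def[abs_def])

lemma Ck_on_2_partial_derivs:
  assumes "Ck_on 2 f S"
  shows "x \<in> S \<Longrightarrow> f differentiable (at x)"
    and "x \<in> S \<Longrightarrow> partial_deriv i f differentiable (at x)"
    and "continuous_on S (partial_deriv i f)"
    and "continuous_on S (partial_deriv j (partial_deriv i f))"
proof -
  have *: "Ck_on (Suc (Suc 0)) f S" using assms by (simp add: numeral_2_eq_2)
  show "x \<in> S \<Longrightarrow> f differentiable (at x)" using * by simp
  show **: "x \<in> S \<Longrightarrow> partial_deriv i f differentiable (at x)" for x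
    using * by (simp add: partial_deriv_def[abs_def])
  show "continuous_on S (partial_deriv i f)"
    using ** by (intro continuous_at_imp_continuous_on ballI differentiable_imp_continuous_within)
  show "continuous_on S (partial_deriv j (partial_deriv i f))"
    using * by (simp add: partial_deriv_def[abs_def])
qed

lemma DERIV_along_line:
  fixes f :: "real ^ 'n \<Rightarrow> real"
  assumes "f differentiable (at (y + s *\<^sub>R z))"
  shows "((\<lambda>s. f (y + s *\<^sub>R z)) has_real_derivative
     (\<Sum>i\<in>UNIV. z $ i * partial_deriv i f (y + s *\<^sub>R z))) (at s)"
proof -
  define D where "D = frechet_derivative f (at (y + s *\<^sub>R z))"
  have D: "(f has_derivative D) (at (y + s *\<^sub>R z))"
    using assms frechet_derivative_works D_def by blast
  interpret D: bounded_linear D using D by (rule has_derivative_bounded_linear)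
  have "((\<lambda>s. f (y + s *\<^sub>R z)) has_derivative (\<lambda>h. D (h *\<^sub>R z))) (at s)"
    using D by (intro has_derivative_compose[where f = "\<lambda>s. y + s *\<^sub>R z" and g = f])
      (auto intro!: derivative_eq_intros)
  moreover have "D (h *\<^sub>R z) = (\<Sum>i\<in>UNIV. z $ i * partial_deriv i f (y + s *\<^sub>R z)) * h" for h
  proof -
    have "D z = D (\<Sum>i\<in>UNIV. z $ i *\<^sub>R axis i 1)"
      using basis_expansion[of z] by (simp add: scalar_mult_eq_scaleR)
    also have "\<dots> = (\<Sum>i\<in>UNIV. z $ i * partial_deriv i f (y + s *\<^sub>R z))"
      by (simp add: D.sum D.scaleR partial_deriv_def flip: D_def)
    finally show ?thesis by (simp add: D.scaleR)
  qed
  ultimately show ?thesis by (simp add: has_field_derivative_def)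
qed

lemma taylor_along_segment:
  fixes f :: "real ^ 'n \<Rightarrow> real"
  assumes C2: "Ck_on 2 f S" and seg: "\<And>s. 0 \<le> s \<Longrightarrow> s \<le> 1 \<Longrightarrow> y + s *\<^sub>R z \<in> S"
  obtains s where "0 < s" "s < 1"
    "f (y + z) = f y + (\<Sum>i\<in>UNIV. partial_deriv i f y * z $ i)
       + (\<Sum>i\<in>UNIV. \<Sum>j\<in>UNIV. partial_deriv j (partial_deriv i f) (y + s *\<^sub>R z) * (z $ i * z $ j)) / 2"
proof -
  define d where "d = (\<lambda>m s. if m = 0 then f (y + s *\<^sub>R z)
     else if m = Suc 0 then \<Sum>i\<in>UNIV. z $ i * partial_deriv i f (y + s *\<^sub>R z)
     else \<Sum>i\<in>UNIV. z $ i * (\<Sum>j\<in>UNIV. z $ j * partial_deriv j (partial_deriv i f) (y + s *\<^sub>R z)))"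
  have d0: "d 0 = (\<lambda>s. f (y + s *\<^sub>R z))" by (simp add: d_def)
  have deriv: "\<forall>m t. m < 2 \<and> 0 \<le> t \<and> t \<le> 1 \<longrightarrow> DERIV (d m) t :> d (Suc m) t"
  proof (intro allI impI, elim conjE)
    fix m :: nat and t :: real assume "m < 2" and t: "0 \<le> t" "t \<le> 1"
    then consider "m = 0" | "m = Suc 0" by linarith
    then show "DERIV (d m) t :> d (Suc m) t"
    proof cases
      case 1
      show ?thesis unfolding 1 d_def
        using DERIV_along_line[OF Ck_on_2_partial_derivs(1)[OF C2 seg[OF t]]] by simp
    next
      case 2
      show ?thesis unfolding 2 d_def
        using DERIV_along_line[OF Ck_on_2_partial_derivs(2)[OF C2 seg[OF t]]]
        by (auto intro!: DERIV_sum DERIV_cmult)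
    qed
  qed
  from Maclaurin[OF _ _ d0 deriv]
  obtain t where t: "0 < t" "t < 1" "f (y + 1 *\<^sub>R z) = (\<Sum>m<2. d m 0 / fact m * 1 ^ m) + d 2 t / fact 2 * 1 ^ 2"
    by auto
  then have "f (y + z) = d 0 0 + d (Suc 0) 0 + d 2 t / 2" by (simp add: numeral_2_eq_2)
  then have "f (y + z) = f y + (\<Sum>i\<in>UNIV. partial_deriv i f y * z $ i)
       + (\<Sum>i\<in>UNIV. \<Sum>j\<in>UNIV. partial_deriv j (partial_deriv i f) (y + t *\<^sub>R z) * (z $ i * z $ j)) / 2"
    by (simp add: d_def sum_distrib_left mult_ac)
  with t that show ?thesis by blast
qed

lemma abs_double_sum_le:
  fixes a :: "'n::finite \<Rightarrow> 'n \<Rightarrow> real" and z :: "real ^ 'n"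
  assumes "\<And>i j. \<bar>a i j\<bar> \<le> c"
  shows "\<bar>\<Sum>i\<in>UNIV. \<Sum>j\<in>UNIV. a i j * (z $ i * z $ j)\<bar> \<le> real CARD('n) ^ 2 * c * norm z ^ 2"
proof -
  have c: "0 \<le> c" using assms[of undefined undefined] by linarith
  have "\<bar>a i j * (z $ i * z $ j)\<bar> \<le> c * norm z ^ 2" for i j
    unfolding abs_mult power2_eq_square
    by (intro mult_mono assms component_le_norm_cart mult_nonneg_nonneg c) auto
  then have "\<bar>\<Sum>i\<in>UNIV. \<Sum>j\<in>UNIV. a i j * (z $ i * z $ j)\<bar>
      \<le> (\<Sum>i\<in>(UNIV::'n set). \<Sum>j\<in>(UNIV::'n set). c * norm z ^ 2)"
    by (intro order_trans[OF sum_abs] sum_mono)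
  then show ?thesis by (simp add: power2_eq_square mult_ac)
qed

text \<open>Inside a small ball the remainder is controlled by the modulus of
  continuity of the second derivatives on a compact neighbourhood of \<open>K\<close>, which gives the small multiple of
  the squared norm. Outside the ball no smoothness is available, as \<open>y + z\<close> may leave \<open>S\<close>; but
  there everything is at most quadratic in \<open>norm z\<close>, hence bounded by a large multiple of the fourth power.
  The combination holds for every \<open>z\<close> and so can be integrated against a Gaussian.
  The function \<open>g\<close> is any bounded extension of \<open>f\<close> beyond \<open>S\<close>.\<close>

lemma uniform_taylor:
  fixes f g :: "real ^ 'n \<Rightarrow> real"
  assumes S: "open S" and K: "compact K" "K \<subseteq> S" and C2: "Ck_on 2 f S"
    and g: "\<And>x. x \<in> S \<Longrightarrow> g x = f x" "\<And>x. \<bar>g x\<bar> \<le> B" and eta: "0 < \<eta>"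
  obtains C where "0 \<le> C" "\<And>y z. y \<in> K \<Longrightarrow>
    \<bar>g (y + z) - f y - (\<Sum>i\<in>UNIV. partial_deriv i f y * z $ i)
      - (\<Sum>i\<in>UNIV. \<Sum>j\<in>UNIV. partial_deriv j (partial_deriv i f) y * (z $ i * z $ j)) / 2\<bar>
      \<le> \<eta> * norm z ^ 2 + C * norm z ^ 4"
proof -
  define n where "n = real CARD('n)"
  have n: "1 \<le> n" by (simp add: n_def)
  define H where "H = (\<lambda>i j. partial_deriv j (partial_deriv i f))"
  \<comment> \<open>The second derivatives are bundled into one matrix-valued function, so that a single
     modulus of continuity and a single bound serve all of them.\<close>
  define HH where "HH = (\<lambda>x. \<chi> i j. H i j x)"
  define DD where "DD = (\<lambda>x. \<chi> i. partial_deriv i f x)"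
  have cHH: "continuous_on S HH" unfolding HH_def H_def
    by (intro continuous_on_vec_lambda Ck_on_2_partial_derivs(4)[OF C2])
  have cDD: "continuous_on S DD" unfolding DD_def
    by (intro continuous_on_vec_lambda Ck_on_2_partial_derivs(3)[OF C2])
  have comp2: "\<bar>A $ i $ j\<bar> \<le> norm A" for A :: "real^'n^'n" and i j
    using component_le_norm_cart[of "A $ i" j] Finite_Cartesian_Product.norm_nth_le[of A i] by linarith
  obtain r where r: "0 < r" "(\<Union>y\<in>K. cball y r) \<subseteq> S"
    using compact_subset_open_imp_cball_epsilon_subset[OF K(1) S K(2)] .
  define K' where "K' = {y + z | y z. y \<in> K \<and> z \<in> cball 0 r}"
  have K': "compact K'" unfolding K'_def by (rule compact_sums[OF K(1) compact_cball])
  have K'S: "K' \<subseteq> S"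
  proof
    fix x assume "x \<in> K'"
    then obtain y z where "y \<in> K" "norm z \<le> r" "x = y + z" by (auto simp: K'_def)
    then have "y \<in> K" "x \<in> cball y r" by (auto simp: dist_norm)
    then show "x \<in> S" using r(2) by blast
  qed
  have eta_n: "0 < \<eta> / n\<^sup>2" using eta n by simp
  have "uniformly_continuous_on K' HH"
    by (intro compact_uniformly_continuous continuous_on_subset[OF cHH K'S] K')
  then obtain \<rho>0 where \<rho>0: "0 < \<rho>0"
    "\<And>x x'. x \<in> K' \<Longrightarrow> x' \<in> K' \<Longrightarrow> dist x' x < \<rho>0 \<Longrightarrow> dist (HH x') (HH x) < \<eta> / n\<^sup>2"
    unfolding uniformly_continuous_on_def using eta_n by meson
  define \<rho> where "\<rho> = min \<rho>0 r"
  have \<rho>: "0 < \<rho>" using \<rho>0 r by (simp add: \<rho>_def)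
  have bdd: "bounded (HH ` K)" "bounded (DD ` K)"
    by (intro compact_imp_bounded compact_continuous_image K
        continuous_on_subset[OF cHH K(2)] continuous_on_subset[OF cDD K(2)])+
  obtain Hm where Hm: "0 < Hm" "\<And>y. y \<in> K \<Longrightarrow> norm (HH y) \<le> Hm"
    using bdd(1) unfolding bounded_pos by blast
  obtain Dm where Dm: "0 < Dm" "\<And>y. y \<in> K \<Longrightarrow> norm (DD y) \<le> Dm"
    using bdd(2) unfolding bounded_pos by blast
  have B: "0 \<le> B" using g(2)[of 0] by linarith
  define C where "C = 2 * B / \<rho> ^ 4 + n * Dm / \<rho> ^ 3 + n\<^sup>2 * Hm / \<rho> ^ 2"
  have C0: "0 \<le> C" using B \<rho> n Hm Dm by (auto simp: C_def)
  show ?thesis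
  proof (rule that[OF C0])
    fix y z assume y: "y \<in> K"
    then have yS: "y \<in> S" using K by auto
    have lin: "\<bar>\<Sum>i\<in>UNIV. partial_deriv i f y * z $ i\<bar> \<le> n * Dm * norm z"
    proof -
      have "\<bar>partial_deriv i f y * z $ i\<bar> \<le> Dm * norm z" for i
        using component_le_norm_cart[of "DD y" i] Dm(2)[OF y] Dm(1)
        unfolding abs_mult by (intro mult_mono component_le_norm_cart) (auto simp: DD_def)
      then have "\<bar>\<Sum>i\<in>UNIV. partial_deriv i f y * z $ i\<bar> \<le> (\<Sum>i\<in>(UNIV::'n set). Dm * norm z)"
        by (intro order_trans[OF sum_abs] sum_mono)
      then show ?thesis by (simp add: n_def mult.assoc)
    qed
    show "\<bar>g (y + z) - f y - (\<Sum>i\<in>UNIV. partial_deriv i f y * z $ i)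
      - (\<Sum>i\<in>UNIV. \<Sum>j\<in>UNIV. partial_deriv j (partial_deriv i f) y * (z $ i * z $ j)) / 2\<bar>
      \<le> \<eta> * norm z ^ 2 + C * norm z ^ 4" (is "\<bar>?R\<bar> \<le> _")
    proof (cases "norm z < \<rho>")
      case True
      have inK': "y + s *\<^sub>R z \<in> K'" if "0 \<le> s" "s \<le> 1" for s
      proof -
        have "s * norm z \<le> 1 * norm z" using that by (intro mult_right_mono) auto
        then have "s *\<^sub>R z \<in> cball 0 r" using True that by (simp add: \<rho>_def)
        then show ?thesis using y unfolding K'_def by blast
      qed
      obtain s where s: "0 < s" "s < 1"
        "f (y + z) = f y + (\<Sum>i\<in>UNIV. partial_deriv i f y * z $ i)
           + (\<Sum>i\<in>UNIV. \<Sum>j\<in>UNIV. H i j (y + s *\<^sub>R z) * (z $ i * z $ j)) / 2"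
        using taylor_along_segment[OF C2, of y z] inK' K'S unfolding H_def by blast
      have "y + z \<in> S" using inK'[of 1] K'S by auto
      then have eq: "?R = (\<Sum>i\<in>UNIV. \<Sum>j\<in>UNIV. (H i j (y + s *\<^sub>R z) - H i j y) * (z $ i * z $ j)) / 2"
        using s(3) g(1) by (simp add: H_def left_diff_distrib sum_subtractf diff_divide_distrib)
      have diff: "\<bar>H i j (y + s *\<^sub>R z) - H i j y\<bar> \<le> \<eta> / n\<^sup>2" for i j
      proof -
        have "norm (s *\<^sub>R z) < \<rho>0"
          using mult_right_mono[of s 1 "norm z"] s True by (simp add: \<rho>_def)
        then have "dist (HH (y + s *\<^sub>R z)) (HH y) < \<eta> / n\<^sup>2"
          using inK'[of 0] inK'[of s] s by (intro \<rho>0(2)) (auto simp: dist_norm)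
        then show ?thesis
          using comp2[of "HH (y + s *\<^sub>R z) - HH y" i j] by (simp add: HH_def dist_norm)
      qed
      have "\<bar>?R\<bar> = \<bar>(\<Sum>i\<in>UNIV. \<Sum>j\<in>UNIV. (H i j (y + s *\<^sub>R z) - H i j y) * (z $ i * z $ j))\<bar> / 2"
        unfolding eq by simp
      also have "\<dots> \<le> (n\<^sup>2 * (\<eta> / n\<^sup>2) * norm z ^ 2) / 2"
        unfolding n_def by (intro divide_right_mono abs_double_sum_le diff[unfolded n_def]) simp
      also have "\<dots> \<le> \<eta> * norm z ^ 2" using eta n by simp
      also have "\<dots> \<le> \<eta> * norm z ^ 2 + C * norm z ^ 4" using C0 by simp
      finally show ?thesis .
    next
      case False
      then have z: "\<rho> \<le> norm z" "0 < norm z" using \<rho> by auto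
      have q: "\<bar>\<Sum>i\<in>UNIV. \<Sum>j\<in>UNIV. partial_deriv j (partial_deriv i f) y * (z $ i * z $ j)\<bar>
          \<le> n\<^sup>2 * Hm * norm z ^ 2"
        unfolding n_def
      proof (rule abs_double_sum_le)
        show "\<bar>partial_deriv j (partial_deriv i f) y\<bar> \<le> Hm" for i j
          using comp2[of "HH y" i j] Hm(2)[OF y] by (simp add: HH_def H_def)
      qed
      have p: "norm z ^ k \<le> norm z ^ 4 / \<rho> ^ (4 - k)" if "k \<le> 4" for k
      proof -
        have "norm z ^ k * \<rho> ^ (4 - k) \<le> norm z ^ k * norm z ^ (4 - k)"
          using z \<rho> by (intro mult_left_mono power_mono) auto
        also have "\<dots> = norm z ^ 4" using that by (simp add: power_add[symmetric])
        finally show ?thesis using \<rho> by (simp add: field_simps)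
      qed
      have "\<bar>?R\<bar> \<le> 2 * B * norm z ^ 0 + n * Dm * norm z ^ 1 + n\<^sup>2 * Hm * norm z ^ 2"
        using lin q g(2)[of "y + z"] g(2)[of y] g(1)[OF yS] n Hm
          mult_nonneg_nonneg[of "n\<^sup>2 * Hm" "norm z ^ 2"] by (simp add: abs_le_iff)
      also have "\<dots> \<le> 2 * B * (norm z ^ 4 / \<rho> ^ (4 - 0)) + n * Dm * (norm z ^ 4 / \<rho> ^ (4 - 1))
           + n\<^sup>2 * Hm * (norm z ^ 4 / \<rho> ^ (4 - 2))"
        using B n Hm Dm by (intro add_mono mult_left_mono p) auto
      also have "\<dots> = C * norm z ^ 4" by (simp add: C_def field_simps)
      also have "\<dots> \<le> \<eta> * norm z ^ 2 + C * norm z ^ 4" using eta by simp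
      finally show ?thesis .
    qed
  qed
qed

section \<open>One Gaussian step applied to the eigenfunction\<close>

text \<open>The linear Taylor term has mean zero and the covariance of \<open>sqrt 2 *\<^sub>R z\<close> is \<open>2 * d\<close> times
  the identity, so the quadratic term integrates to \<open>d\<close> times the Laplacian. The remainder is
  \<open>o(d)\<close> by the second and fourth moments.\<close>

lemma gauss_generator:
  fixes f g :: "real ^ 'n \<Rightarrow> real"
  assumes S: "open S" and K: "compact K" "K \<subseteq> S" and C2: "Ck_on 2 f S"
    and g: "\<And>x. x \<in> S \<Longrightarrow> g x = f x" "\<And>x. \<bar>g x\<bar> \<le> B"
    and gm [measurable]: "g \<in> borel_measurable borel" and eta: "0 < \<eta>"
  obtains d0 where "0 < d0" "\<And>d y. 0 < d \<Longrightarrow> d \<le> d0 \<Longrightarrow> y \<in> K \<Longrightarrow>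
    \<bar>(\<integral>z. g (y + sqrt 2 *\<^sub>R z) \<partial>gauss d) - f y - d * laplacian f y\<bar> \<le> \<eta> * d"
proof -
  define n where "n = real CARD('n)"
  have n: "1 \<le> n" by (simp add: n_def)
  have "0 < \<eta> / (4 * n)" using eta n by simp
  then obtain C where C: "0 \<le> C" "\<And>y z. y \<in> K \<Longrightarrow>
    \<bar>g (y + z) - f y - (\<Sum>i\<in>UNIV. partial_deriv i f y * z $ i)
      - (\<Sum>i\<in>UNIV. \<Sum>j\<in>UNIV. partial_deriv j (partial_deriv i f) y * (z $ i * z $ j)) / 2\<bar>
      \<le> \<eta> / (4 * n) * norm z ^ 2 + C * norm z ^ 4"
    using uniform_taylor[OF S K C2 g, of "\<eta> / (4 * n)"] by blast
  \<comment> \<open>Chosen so that the fourth-moment term \<open>12 * C * n\<^sup>2 * d\<^sup>2\<close> is at most \<open>\<eta> * d / 2\<close>; the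
     summand 1 covers \<open>C = 0\<close>.\<close>
  define d0 where "d0 = \<eta> / (24 * C * n\<^sup>2 + 1)"
  have den: "0 < 24 * C * n\<^sup>2 + 1" using C(1) by (intro add_nonneg_pos) auto
  have d0: "0 < d0" using eta den by (simp add: d0_def)
  show ?thesis
  proof (rule that[OF d0])
    fix d y assume d: "0 < d" "d \<le> d0" and y: "y \<in> K"
    interpret prob_space "gauss d :: (real^'n) measure" by (rule prob_space_gauss[OF d(1)])
    define R where "R = (\<lambda>z. g (y + sqrt 2 *\<^sub>R z) - f y - sqrt 2 * (\<Sum>i\<in>UNIV. partial_deriv i f y * z $ i)
      - (\<Sum>i\<in>UNIV. \<Sum>j\<in>UNIV. partial_deriv j (partial_deriv i f) y * (z $ i * z $ j)))"
    have R_le: "\<bar>R z\<bar> \<le> \<eta> / (2 * n) * norm z ^ 2 + 4 * C * norm z ^ 4" for z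
    proof -
      have "R z = g (y + sqrt 2 *\<^sub>R z) - f y - (\<Sum>i\<in>UNIV. partial_deriv i f y * (sqrt 2 *\<^sub>R z) $ i)
        - (\<Sum>i\<in>UNIV. \<Sum>j\<in>UNIV. partial_deriv j (partial_deriv i f) y
             * ((sqrt 2 *\<^sub>R z) $ i * (sqrt 2 *\<^sub>R z) $ j)) / 2"
      proof -
        have "(\<Sum>i\<in>UNIV. \<Sum>j\<in>UNIV. partial_deriv j (partial_deriv i f) y
             * ((sqrt 2 *\<^sub>R z) $ i * (sqrt 2 *\<^sub>R z) $ j))
          = 2 * (\<Sum>i\<in>UNIV. \<Sum>j\<in>UNIV. partial_deriv j (partial_deriv i f) y * (z $ i * z $ j))"
          unfolding sum_distrib_left by (intro sum.cong refl) (simp add: algebra_simps)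
        moreover have "(\<Sum>i\<in>UNIV. partial_deriv i f y * (sqrt 2 *\<^sub>R z) $ i)
            = sqrt 2 * (\<Sum>i\<in>UNIV. partial_deriv i f y * z $ i)"
          unfolding sum_distrib_left by (intro sum.cong refl) simp
        ultimately show ?thesis by (simp add: R_def)
      qed
      also have "\<bar>\<dots>\<bar> \<le> \<eta> / (4 * n) * norm (sqrt 2 *\<^sub>R z) ^ 2 + C * norm (sqrt 2 *\<^sub>R z) ^ 4"
        by (rule C(2)[OF y])
      also have "\<dots> = \<eta> / (2 * n) * norm z ^ 2 + 4 * C * norm z ^ 4"
      proof -
        have "sqrt 2 ^ 4 = (4::real)" using power_mult[of "sqrt 2" 2 2] by simp
        then show ?thesis using n by (simp add: power_mult_distrib field_simps)
      qed
      finally show ?thesis .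
    qed
    have gi: "integrable (gauss d) (\<lambda>z. g (y + sqrt 2 *\<^sub>R z))"
      by (rule integrable_const_bound[of _ B]) (auto simp: g(2))
    have "has_bochner_integral (gauss d) R ((\<integral>z. g (y + sqrt 2 *\<^sub>R z) \<partial>gauss d) - f y
        - sqrt 2 * (\<Sum>i\<in>UNIV. partial_deriv i f y * 0)
        - (\<Sum>i\<in>UNIV. \<Sum>j\<in>UNIV. partial_deriv j (partial_deriv i f) y * (if i = j then d else 0)))"
      unfolding R_def
      by (intro has_bochner_integral_diff has_bochner_integral_sum has_bochner_integral_mult_right
          gauss_mean gauss_covariance d has_bochner_integral_integrable[OF gi])
        (use prob_space in \<open>simp add: has_bochner_integral_iff\<close>)
    then have R_int: "has_bochner_integral (gauss d) R
        ((\<integral>z. g (y + sqrt 2 *\<^sub>R z) \<partial>gauss d) - f y - d * laplacian f y)"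
      by (simp add: laplacian_eq_partial_derivs sum_distrib_left mult.commute[of d]
          if_distrib[where f = "\<lambda>x. _ * x"] cong: if_cong)
    have i24: "integrable (gauss d) (\<lambda>z::real^'n. \<eta> / (2 * n) * norm z ^ 2 + 4 * C * norm z ^ 4)"
      using gauss_norm_power2[OF d(1), where 'n = 'n] gauss_norm_power4(1)[OF d(1), where 'n = 'n]
      by (auto simp: has_bochner_integral_iff)
    have "\<bar>integral\<^sup>L (gauss d) R\<bar> \<le> (\<integral>z. \<bar>R z\<bar> \<partial>gauss d)"
      by (rule integral_abs_bound)
    also have "\<dots> \<le> (\<integral>z. \<eta> / (2 * n) * norm (z::real^'n) ^ 2 + 4 * C * norm z ^ 4 \<partial>gauss d)"
      using R_int by (intro integral_mono i24 R_le integrable_abs) (simp add: has_bochner_integral_iff)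
    also have "\<dots> = \<eta> / (2 * n) * (n * d) + 4 * C * (\<integral>z. norm (z::real^'n) ^ 4 \<partial>gauss d)"
      using gauss_norm_power2[OF d(1), where 'n = 'n] gauss_norm_power4(1)[OF d(1), where 'n = 'n]
      by (simp add: has_bochner_integral_iff n_def)
    also have "\<dots> \<le> \<eta> / (2 * n) * (n * d) + 4 * C * (3 * n\<^sup>2 * d\<^sup>2)"
      using gauss_norm_power4(2)[OF d(1), where 'n = 'n] C(1)
      by (intro add_left_mono mult_left_mono) (auto simp: n_def)
    also have "\<dots> = \<eta> * d / 2 + 12 * C * n\<^sup>2 * d * d"
      using n by (simp add: power2_eq_square)
    also have "12 * C * n\<^sup>2 * d * d \<le> \<eta> / 2 * d"
    proof (rule mult_right_mono)
      have "24 * C * n\<^sup>2 * d \<le> (24 * C * n\<^sup>2 + 1) * d" using d by (simp add: algebra_simps)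
      also have "\<dots> \<le> \<eta>" using d(2) den by (simp add: d0_def field_simps)
      finally show "12 * C * n\<^sup>2 * d \<le> \<eta> / 2" by simp
    qed (use d in simp)
    finally show "\<bar>(\<integral>z. g (y + sqrt 2 *\<^sub>R z) \<partial>gauss d) - f y - d * laplacian f y\<bar> \<le> \<eta> * d"
      using has_bochner_integral_integral_eq[OF R_int] by simp
  qed
qed

text \<open>By the equation, the Gaussian mean of \<open>g\<close> is \<open>(1 + x) * f y + o(d)\<close> with
  \<open>x = (V y - lam) * d\<close>, and \<open>exp (- x) * (1 + x)\<close> is \<open>1\<close> up to \<open>x\<^sup>2\<close>. The absolute value may
  be taken inside the integral because only an upper bound is wanted.\<close>

lemma one_step_estimate:
  fixes f g V :: "real ^ 'n \<Rightarrow> real"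
  assumes S: "open S" and K: "compact K" "K \<subseteq> S" and C2: "Ck_on 2 f S"
    and V: "continuous_on S V" and pde: "\<And>x. x \<in> S \<Longrightarrow> - laplacian f x + V x * f x = lam * f x"
    and g: "\<And>x. x \<in> S \<Longrightarrow> g x = f x" "\<And>x. \<bar>g x\<bar> \<le> B"
    and gm [measurable]: "g \<in> borel_measurable borel" and eta: "0 < \<eta>"
  obtains d0 where "0 < d0" "\<And>d y. 0 < d \<Longrightarrow> d \<le> d0 \<Longrightarrow> y \<in> K \<Longrightarrow>
    \<bar>f y\<bar> \<le> exp ((lam - V y) * d) * (\<integral>z. \<bar>g (y + sqrt 2 *\<^sub>R z)\<bar> \<partial>gauss d) + \<eta> * d"
proof -
  have "continuous_on K (\<lambda>x. V x - lam)"
    by (intro continuous_intros continuous_on_subset[OF V K(2)])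
  then have "bounded ((\<lambda>x. V x - lam) ` K)"
    by (intro compact_imp_bounded compact_continuous_image K)
  then obtain A where A: "0 < A" "\<And>y. y \<in> K \<Longrightarrow> \<bar>V y - lam\<bar> \<le> A"
    unfolding bounded_pos by auto
  have B: "0 \<le> B" using g(2)[of 0] by linarith
  \<comment> \<open>The constant 6 is 2 times the bound 3 for \<open>exp (- x)\<close>; half of the error is kept for the
     quadratic defect of \<open>exp (- x) * (1 + x)\<close>.\<close>
  have "0 < \<eta> / 6" using eta by simp
  then obtain d1 where d1: "0 < d1" "\<And>d y. 0 < d \<Longrightarrow> d \<le> d1 \<Longrightarrow> y \<in> K \<Longrightarrow>
    \<bar>(\<integral>z. g (y + sqrt 2 *\<^sub>R z) \<partial>gauss d) - f y - d * laplacian f y\<bar> \<le> \<eta> / 6 * d"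
    using gauss_generator[OF S K C2 g gm, of "\<eta> / 6"] by blast
  \<comment> \<open>The second bound makes \<open>\<bar>x\<bar> \<le> 1\<close>, the third makes \<open>x\<^sup>2 * \<bar>f y\<bar>\<close> at most \<open>\<eta> * d / 2\<close>.\<close>
  define d0 where "d0 = min d1 (min (1 / A) (\<eta> / (2 * (A\<^sup>2 * B + 1))))"
  have AB: "0 < A\<^sup>2 * B + 1" using B by (intro add_nonneg_pos) auto
  have d0: "0 < d0" using d1 A eta AB by (simp add: d0_def)
  show ?thesis
  proof (rule that[OF d0])
    fix d y assume d: "0 < d" "d \<le> d0" and y: "y \<in> K"
    define x where "x = (V y - lam) * d"
    define E where "E = (\<integral>z. g (y + sqrt 2 *\<^sub>R z) \<partial>gauss d)"
    have fB: "\<bar>f y\<bar> \<le> B" using g y K(2) by (metis subsetD)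
    have "\<bar>x\<bar> \<le> A * d" using A(2)[OF y] d by (simp add: x_def abs_mult)
    moreover have "A * d \<le> 1" using d A(1) by (simp add: d0_def field_simps)
    ultimately have x: "\<bar>x\<bar> \<le> A * d" "\<bar>x\<bar> \<le> 1" by auto
    have lap: "d * laplacian f y = x * f y"
    proof -
      have "laplacian f y = (V y - lam) * f y"
        using pde[of y] y K(2) by (auto simp: left_diff_distrib)
      then show ?thesis by (simp add: x_def)
    qed
    have "\<bar>E - f y - x * f y\<bar> \<le> \<eta> / 6 * d"
      unfolding E_def lap[symmetric] using d by (intro d1(2) y) (auto simp: d0_def)
    then have E: "(1 + x) * \<bar>f y\<bar> \<le> \<bar>E\<bar> + \<eta> / 6 * d"
    proof -
      have "(1 + x) * \<bar>f y\<bar> = \<bar>f y + x * f y\<bar>"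
      proof -
        have "f y + x * f y = (1 + x) * f y" by (simp add: algebra_simps)
        then show ?thesis using x(2) by (simp add: abs_mult)
      qed
      then show ?thesis using \<open>\<bar>E - f y - x * f y\<bar> \<le> \<eta> / 6 * d\<close> by linarith
    qed
    have "1 - x\<^sup>2 = (1 + - x) * (1 + x)" by (simp add: power2_eq_square algebra_simps)
    also have "\<dots> \<le> exp (- x) * (1 + x)"
      using x(2) by (intro mult_right_mono exp_ge_add_one_self) auto
    finally have "(1 - x\<^sup>2) * \<bar>f y\<bar> \<le> exp (- x) * (1 + x) * \<bar>f y\<bar>"
      by (rule mult_right_mono) simp
    also have "\<dots> = exp (- x) * ((1 + x) * \<bar>f y\<bar>)" by (simp only: mult.assoc)
    also have "\<dots> \<le> exp (- x) * (\<bar>E\<bar> + \<eta> / 6 * d)"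
      by (intro mult_left_mono E) simp
    finally have 1: "\<bar>f y\<bar> \<le> exp (- x) * \<bar>E\<bar> + exp (- x) * (\<eta> / 6 * d) + x\<^sup>2 * \<bar>f y\<bar>"
      by (simp add: algebra_simps)
    have "exp (- x) \<le> exp 1" using x(2) by simp
    also have "\<dots> \<le> 3" by (rule exp_le)
    finally have "exp (- x) * (\<eta> / 6 * d) \<le> 3 * (\<eta> / 6 * d)"
      using eta d by (intro mult_right_mono) auto
    then have 2: "exp (- x) * (\<eta> / 6 * d) \<le> \<eta> * d / 2" by simp
    have "x\<^sup>2 * \<bar>f y\<bar> \<le> (A * d)\<^sup>2 * B"
      using x(1) fB B by (intro mult_mono) (auto simp: abs_le_square_iff[symmetric])
    also have "\<dots> = (A\<^sup>2 * B * d) * d" by (simp add: power2_eq_square)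
    also have "\<dots> \<le> \<eta> / 2 * d"
    proof (rule mult_right_mono)
      have "A\<^sup>2 * B * d \<le> (A\<^sup>2 * B + 1) * d" using d by (simp add: algebra_simps)
      also have "\<dots> \<le> \<eta> / 2" using d(2) AB by (simp add: d0_def field_simps)
      finally show "A\<^sup>2 * B * d \<le> \<eta> / 2" .
    qed (use d in simp)
    finally have 3: "x\<^sup>2 * \<bar>f y\<bar> \<le> \<eta> * d / 2" by simp
    have 4: "\<bar>E\<bar> \<le> (\<integral>z. \<bar>g (y + sqrt 2 *\<^sub>R z)\<bar> \<partial>gauss d)"
      unfolding E_def by (rule integral_abs_bound)
    have 5: "exp (- x) * \<bar>E\<bar> \<le> exp (- x) * (\<integral>z. \<bar>g (y + sqrt 2 *\<^sub>R z)\<bar> \<partial>gauss d)"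
      by (intro mult_left_mono 4) simp
    have 6: "(lam - V y) * d = - x" by (simp add: x_def algebra_simps)
    show "\<bar>f y\<bar> \<le> exp ((lam - V y) * d) * (\<integral>z. \<bar>g (y + sqrt 2 *\<^sub>R z)\<bar> \<partial>gauss d) + \<eta> * d"
      unfolding 6 using 1 2 3 5 by linarith
  qed
qed

section \<open>Iterated steps and Brownian motion on a time grid\<close>

text \<open>One step of the discretized semigroup: weight \<open>q\<close> at the current position, then the
  heat flow with generator the full Laplacian for time \<open>d\<close>. Killing outside a set is
  encoded by letting \<open>q\<close> vanish there.\<close>

definition weighted_step ::
  "real \<Rightarrow> (real ^ 'n \<Rightarrow> ennreal) \<Rightarrow> (real ^ 'n \<Rightarrow> ennreal) \<Rightarrow> real ^ 'n \<Rightarrow> ennreal" where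
  "weighted_step d q f y = q y * (\<integral>\<^sup>+ z. f (y + sqrt 2 *\<^sub>R z) \<partial>gauss d)"

lemma measurable_weighted_step:
  assumes "0 < d" and [measurable]: "q \<in> borel_measurable borel" "f \<in> borel_measurable borel"
  shows "weighted_step d q f \<in> borel_measurable borel"
proof -
  interpret sigma_finite_measure "gauss d :: (real^'n) measure"
    by (intro prob_space_imp_sigma_finite prob_space_gauss assms)
  show ?thesis unfolding weighted_step_def[abs_def] by measurable
qed

lemma measurable_weighted_step_iterate:
  assumes "0 < d" "q \<in> borel_measurable borel" "f \<in> borel_measurable borel"
  shows "(weighted_step d q ^^ k) f \<in> borel_measurable borel"
  by (induction k) (simp_all add: assms measurable_weighted_step)

text \<open>An error made at one step is amplified by at most a factor \<open>c\<close> in each further step. The bound \<open>e\<close>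
  off \<open>K\<close> is used at most once along a path, since \<open>inside\<close> is only invoked while the path is in \<open>K\<close>;
  hence \<open>e\<close> does not accumulate with \<open>k\<close>, whereas the local error \<open>a\<close> does.\<close>

lemma le_weighted_step_iterate:
  fixes u q :: "real ^ 'n \<Rightarrow> ennreal"
  assumes d: "0 < d" and [measurable]: "q \<in> borel_measurable borel" "u \<in> borel_measurable borel"
    and K: "K \<in> sets borel" and c: "1 \<le> c" and a: "0 \<le> a" and e: "0 \<le> e"
    and q: "\<And>y. q y \<le> ennreal c"
    and inside: "\<And>y. y \<in> K \<Longrightarrow> u y \<le> weighted_step d q u y + ennreal a"
    and outside: "\<And>y. y \<notin> K \<Longrightarrow> u y \<le> ennreal e"
  shows "u y \<le> (weighted_step d q ^^ k) (\<lambda>y. indicator K y * u y) y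
           + ennreal (c ^ k * (e + real k * a))"
proof (induction k arbitrary: y)
  case 0
  show ?case using outside[of y] by (cases "y \<in> K") auto
next
  case (Suc k)
  interpret prob_space "gauss d :: (real^'n) measure" by (rule prob_space_gauss[OF d])
  define F where "F = (weighted_step d q ^^ k) (\<lambda>y. indicator K y * u y)"
  have [measurable]: "K \<in> sets borel" by (rule K)
  have F [measurable]: "F \<in> borel_measurable borel"
    unfolding F_def by (intro measurable_weighted_step_iterate d) measurable
  define C where "C = c ^ k * (e + real k * a)"
  have C: "0 \<le> C" using a e c by (simp add: C_def)
  have ck: "1 \<le> c ^ Suc k" using c by (rule one_le_power)
  show ?case
  proof (cases "y \<in> K")
    case True
    have "weighted_step d q u y \<le> q y * (\<integral>\<^sup>+ z. F (y + sqrt 2 *\<^sub>R z) + ennreal C \<partial>gauss d)"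
      unfolding weighted_step_def using Suc.IH
      by (intro mult_left_mono nn_integral_mono) (auto simp: F_def C_def)
    also have "(\<integral>\<^sup>+ z. F (y + sqrt 2 *\<^sub>R z) + ennreal C \<partial>gauss d)
        = (\<integral>\<^sup>+ z. F (y + sqrt 2 *\<^sub>R z) \<partial>gauss d) + ennreal C"
      using emeasure_space_1 by (subst nn_integral_add) auto
    also have "q y * \<dots> = weighted_step d q F y + q y * ennreal C"
      by (simp add: weighted_step_def distrib_left)
    also have "\<dots> \<le> weighted_step d q F y + ennreal c * ennreal C"
      by (intro add_left_mono mult_right_mono q) simp
    finally have "u y \<le> weighted_step d q F y + ennreal c * ennreal C + ennreal a"
      using inside[OF True] by (meson add_right_mono order_trans)
    also have "\<dots> = weighted_step d q F y + ennreal (c * C + a)"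
      using C c a by (simp add: ennreal_mult add.assoc)
    also have "\<dots> \<le> weighted_step d q F y + ennreal (c ^ Suc k * (e + real (Suc k) * a))"
    proof (intro add_left_mono ennreal_leI)
      have "a \<le> c ^ Suc k * a" using mult_right_mono[OF ck a] by simp
      then show "c * C + a \<le> c ^ Suc k * (e + real (Suc k) * a)"
        by (simp add: C_def algebra_simps)
    qed
    finally show ?thesis by (simp add: F_def)
  next
    case False
    have "e \<le> c ^ Suc k * (e + real (Suc k) * a)"
      using mult_mono[OF ck, of e "e + real (Suc k) * a"] a e ck by simp
    then have "ennreal e \<le> ennreal (c ^ Suc k * (e + real (Suc k) * a))" by (rule ennreal_leI)
    then show ?thesis using outside[OF False] by (meson add_increasing order_trans zero_le)
  qed
qed

text \<open>Splitting off the innermost application, that is the last increment, lets the induction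
  use Fubini on the product over \<open>insert N {..<N}\<close> without renumbering; this is why \<open>f\<close> is
  generalized.\<close>

lemma weighted_step_iterate_eq_PiM:
  fixes q f :: "real ^ 'n \<Rightarrow> ennreal"
  assumes d: "0 < d" and q [measurable]: "q \<in> borel_measurable borel"
    and "f \<in> borel_measurable borel"
  shows "(weighted_step d q ^^ N) f x =
    (\<integral>\<^sup>+ z. (\<Prod>j<N. q (x + sqrt 2 *\<^sub>R (\<Sum>i<j. z i))) * f (x + sqrt 2 *\<^sub>R (\<Sum>i<N. z i))
       \<partial>(\<Pi>\<^sub>M i\<in>{..<N}. gauss d))"
  using assms(3)
proof (induction N arbitrary: f)
  case 0
  show ?case by (simp add: PiM_empty nn_integral_count_space_finite)
next
  case (Suc N)
  note [measurable] = Suc.prems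
  interpret prob_space "gauss d :: (real^'n) measure" by (rule prob_space_gauss[OF d])
  interpret product_sigma_finite "\<lambda>_::nat. gauss d :: (real^'n) measure"
    by (intro product_sigma_finite.intro sigma_finite_measure_axioms)
  define X where "X = (\<lambda>j (z :: nat \<Rightarrow> real^'n). x + sqrt 2 *\<^sub>R (\<Sum>i<j. z i))"
  have X_meas: "X j \<in> borel_measurable (\<Pi>\<^sub>M i\<in>I. gauss d)" if "{..<j} \<subseteq> I" for j I
    unfolding X_def
    by (intro borel_measurable_add borel_measurable_const borel_measurable_scaleR
        borel_measurable_sum measurable_compose[OF measurable_component_singleton]) (use that in auto)
  have prod_meas: "(\<lambda>z. \<Prod>j<k. q (X j z)) \<in> borel_measurable (\<Pi>\<^sub>M i\<in>{..<m}. gauss d)"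
    if "k \<le> Suc m" for k m
    by (intro borel_measurable_prod_ennreal measurable_compose[OF X_meas q]) (use that in auto)
  have upd: "X j (z(N := z')) = X j z" if "j \<le> N" for j z z'
    using that unfolding X_def by (intro arg_cong2[where f = "(+)"] arg_cong2[where f = scaleR] refl sum.cong) auto
  have last: "X (Suc N) (z(N := z')) = X N z + sqrt 2 *\<^sub>R z'" for z z'
    using upd[of N z z'] by (simp add: X_def scaleR_add_right add.assoc)
  have "(weighted_step d q ^^ Suc N) f x = (weighted_step d q ^^ N) (weighted_step d q f) x"
    by (simp add: funpow_swap1)
  also have "\<dots> = (\<integral>\<^sup>+ z. (\<Prod>j<N. q (X j z)) * weighted_step d q f (X N z) \<partial>(\<Pi>\<^sub>M i\<in>{..<N}. gauss d))"
    unfolding X_def by (rule Suc.IH) (intro measurable_weighted_step d q Suc.prems)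
  also have "\<dots> = (\<integral>\<^sup>+ z. (\<integral>\<^sup>+ z'. (\<Prod>j<Suc N. q (X j (z(N := z')))) * f (X (Suc N) (z(N := z')))
       \<partial>gauss d) \<partial>(\<Pi>\<^sub>M i\<in>{..<N}. gauss d))"
  proof (rule nn_integral_cong)
    fix z
    have "(\<Prod>j<Suc N. q (X j (z(N := z')))) = (\<Prod>j<Suc N. q (X j z))" for z'
      by (intro prod.cong) (auto simp: upd)
    then have "(\<integral>\<^sup>+ z'. (\<Prod>j<Suc N. q (X j (z(N := z')))) * f (X (Suc N) (z(N := z'))) \<partial>gauss d)
        = (\<integral>\<^sup>+ z'. (\<Prod>j<Suc N. q (X j z)) * f (X N z + sqrt 2 *\<^sub>R z') \<partial>gauss d)"
      by (simp only: last)
    also have "\<dots> = (\<Prod>j<Suc N. q (X j z)) * (\<integral>\<^sup>+ z'. f (X N z + sqrt 2 *\<^sub>R z') \<partial>gauss d)"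
      by (rule nn_integral_cmult) measurable
    finally show "(\<Prod>j<N. q (X j z)) * weighted_step d q f (X N z) =
       (\<integral>\<^sup>+ z'. (\<Prod>j<Suc N. q (X j (z(N := z')))) * f (X (Suc N) (z(N := z'))) \<partial>gauss d)"
      by (simp add: weighted_step_def mult.assoc)
  qed
  also have "\<dots> = (\<integral>\<^sup>+ z. (\<Prod>j<Suc N. q (X j z)) * f (X (Suc N) z) \<partial>(\<Pi>\<^sub>M i\<in>{..<Suc N}. gauss d))"
  proof -
    define G where "G = (\<lambda>z. (\<Prod>j<Suc N. q (X j z)) * f (X (Suc N) z))"
    have "G \<in> borel_measurable (\<Pi>\<^sub>M i\<in>{..<Suc N}. gauss d)"
      unfolding G_def
      by (intro borel_measurable_times_ennreal prod_meas measurable_compose[OF X_meas Suc.prems]) auto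
    then have "integral\<^sup>N (\<Pi>\<^sub>M i\<in>insert N {..<N}. gauss d) G
        = (\<integral>\<^sup>+ z. (\<integral>\<^sup>+ z'. G (z(N := z')) \<partial>gauss d) \<partial>(\<Pi>\<^sub>M i\<in>{..<N}. gauss d))"
      unfolding lessThan_Suc by (intro product_nn_integral_insert) auto
    then show ?thesis unfolding G_def lessThan_Suc[of N] by (rule sym)
  qed
  finally show ?case by (simp add: X_def)
qed

text \<open>The increments over the grid cells are independent with law \<open>gauss d\<close>, so their joint law is
  the product measure, and the path at grid times is a partial sum of them.\<close>

lemma (in standard_brownian_motion) nn_integral_bm_grid:
  assumes d: "0 < d" and q: "q \<in> borel_measurable borel" and f: "f \<in> borel_measurable borel"
  shows "(\<integral>\<^sup>+ w. (\<Prod>j<N. q (bm_path W x w (real j * d))) * f (bm_path W x w (real N * d)) \<partial>M)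
    = (weighted_step d q ^^ N) f x"
proof (cases "N = 0")
  case True
  have "(\<integral>\<^sup>+ w. f (bm_path W x w 0) \<partial>M) = (\<integral>\<^sup>+ w. f x \<partial>M)"
    by (intro nn_integral_cong) (simp add: bm_path_def start_zero)
  then show ?thesis using True emeasure_space_1 by simp
next
  case False
  define Z where "Z = (\<lambda>i w. W (real (Suc i) * d) w - W (real i * d) w)"
  have dist: "distributed M lborel (Z i) (\<lambda>y. ennreal (\<Prod>i\<in>UNIV. normal_density 0 (sqrt d) (y $ i)))" for i
    using gaussian_increments[of "real i * d" "real (Suc i) * d"] d
    unfolding Z_def by (simp add: algebra_simps)
  then have Zm: "Z i \<in> borel_measurable M" for i
    using distributed_measurable by fastforce
  have law: "distr M borel (Z i) = gauss d" for i
    using distributed_distr_eq_density[OF dist[of i]]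
    by (simp add: gauss_def cong: distr_cong)
  have "indep_vars (\<lambda>_. borel) Z {..<N}"
    unfolding Z_def using d by (intro independent_increments[of "\<lambda>i. real i * d" N]) auto
  then have joint: "distr M (\<Pi>\<^sub>M i\<in>{..<N}. borel) (\<lambda>w. \<lambda>i\<in>{..<N}. Z i w) = (\<Pi>\<^sub>M i\<in>{..<N}. gauss d)"
    using False Zm by (subst (asm) indep_vars_iff_distr_eq_PiM') (auto simp: law)
  have path: "bm_path W x w (real j * d) = x + sqrt 2 *\<^sub>R (\<Sum>i<j. Z i w)" if "w \<in> space M" for j w
  proof -
    have "(\<Sum>i<j. Z i w) = W (real j * d) w"
      unfolding Z_def using sum_lessThan_telescope[of "\<lambda>i. W (real i * d) w" j] start_zero[OF that] by simp
    then show ?thesis by (simp add: bm_path_def)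
  qed
  define G where "G = (\<lambda>z :: nat \<Rightarrow> real^'n. (\<Prod>j<N. q (x + sqrt 2 *\<^sub>R (\<Sum>i<j. z i))) * f (x + sqrt 2 *\<^sub>R (\<Sum>i<N. z i)))"
  have X_meas: "(\<lambda>z. x + sqrt 2 *\<^sub>R (\<Sum>i<j. z i)) \<in> borel_measurable (\<Pi>\<^sub>M i\<in>{..<N}. borel)"
    if "j \<le> N" for j
    by (intro borel_measurable_add borel_measurable_const borel_measurable_scaleR
        borel_measurable_sum measurable_component_singleton) (use that in auto)
  have Gm: "G \<in> borel_measurable (\<Pi>\<^sub>M i\<in>{..<N}. borel)"
    unfolding G_def by (intro borel_measurable_times_ennreal borel_measurable_prod_ennreal
        measurable_compose[OF X_meas q] measurable_compose[OF X_meas f]) auto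
  have "(\<integral>\<^sup>+ w. (\<Prod>j<N. q (bm_path W x w (real j * d))) * f (bm_path W x w (real N * d)) \<partial>M)
      = (\<integral>\<^sup>+ w. G (\<lambda>i\<in>{..<N}. Z i w) \<partial>M)"
  proof (rule nn_integral_cong)
    fix w assume w: "w \<in> space M"
    have "(\<Sum>i<j. (\<lambda>i\<in>{..<N}. Z i w) i) = (\<Sum>i<j. Z i w)" if "j \<le> N" for j
      using that by (intro sum.cong) auto
    then show "(\<Prod>j<N. q (bm_path W x w (real j * d))) * f (bm_path W x w (real N * d))
        = G (\<lambda>i\<in>{..<N}. Z i w)"
      unfolding G_def path[OF w] by (intro arg_cong2[where f = "(*)"] prod.cong) simp_all
  qed
  also have "\<dots> = (\<integral>\<^sup>+ z. G z \<partial>distr M (\<Pi>\<^sub>M i\<in>{..<N}. borel) (\<lambda>w. \<lambda>i\<in>{..<N}. Z i w))"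
    by (intro nn_integral_distr[symmetric] measurable_restrict Zm) (use Gm in simp)
  also have "\<dots> = (weighted_step d q ^^ N) f x"
    unfolding joint G_def by (rule weighted_step_iterate_eq_PiM[OF d q f, symmetric])
  finally show ?thesis .
qed

section \<open>Refining the grid along a single path\<close>

lemma left_riemann_sums_tendsto_integral:
  fixes f :: "real \<Rightarrow> real"
  assumes t: "0 < t" and f: "continuous_on {0..t} f"
  shows "(\<lambda>N. \<Sum>j<Suc N. f (real j * (t / real (Suc N))) * (t / real (Suc N))) \<longlonglongrightarrow> integral {0..t} f"
proof (rule LIMSEQ_I)
  fix e :: real assume e: "0 < e"
  have "uniformly_continuous_on {0..t} f" by (intro compact_uniformly_continuous f) simp
  moreover have "0 < e / (2 * t)" using e t by simp
  ultimately obtain \<delta> where \<delta>: "0 < \<delta>"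
    "\<And>s s'. s \<in> {0..t} \<Longrightarrow> s' \<in> {0..t} \<Longrightarrow> dist s' s < \<delta> \<Longrightarrow> dist (f s') (f s) < e / (2 * t)"
    unfolding uniformly_continuous_on_def by meson
  obtain m :: nat where m: "t / \<delta> < real m" using reals_Archimedean2 by blast
  show "\<exists>no. \<forall>N\<ge>no. norm ((\<Sum>j<Suc N. f (real j * (t / real (Suc N))) * (t / real (Suc N)))
      - integral {0..t} f) < e"
  proof (intro exI[of _ m] allI impI)
    fix N assume "m \<le> N"
    define d where "d = t / real (Suc N)"
    have d: "0 < d" using t by (simp add: d_def)
    have "t / \<delta> < real (Suc N)" using m \<open>m \<le> N\<close> by linarith
    then have dd: "d < \<delta>" using \<delta>(1) by (simp add: d_def field_simps)
    have dt: "real (Suc N) * d = t" by (simp add: d_def)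
    have part: "\<bar>(\<Sum>j<k. f (real j * d) * d) - integral {0..real k * d} f\<bar> \<le> real k * d * (e / (2 * t))"
      if "k \<le> Suc N" for k
      using that
    proof (induction k)
      case 0
      show ?case by simp
    next
      case (Suc k)
      define a b where "a = real k * d" and "b = real (Suc k) * d"
      have ab: "0 \<le> a" "a \<le> b" "b - a = d" using d by (auto simp: a_def b_def algebra_simps)
      have bt: "b \<le> t" unfolding b_def dt[symmetric]
        using Suc.prems d by (intro mult_right_mono) auto
      have ca: "continuous_on {a..b} f" using ab bt by (intro continuous_on_subset[OF f]) auto
      have "f integrable_on {0..b}"
        using ab bt by (intro integrable_continuous_interval continuous_on_subset[OF f]) auto
      then have split: "integral {0..a} f + integral {a..b} f = integral {0..b} f"
        using ab by (intro Henstock_Kurzweil_Integration.integral_combine) auto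
      have "\<bar>integral {a..b} (\<lambda>s. f s - f a)\<bar> \<le> e / (2 * t) * (b - a)"
        unfolding real_norm_def[symmetric]
      proof (rule integral_bound[OF ab(2)])
        show "continuous_on {a..b} (\<lambda>s. f s - f a)" by (intro continuous_intros ca)
        show "norm (f s - f a) \<le> e / (2 * t)" if "s \<in> {a..b}" for s
          using \<delta>(2)[of a s] that ab bt dd by (auto simp: dist_real_def)
      qed
      moreover have "integral {a..b} (\<lambda>s. f s - f a) = integral {a..b} f - f a * d"
        using ab ca by (subst integral_diff) (auto intro: integrable_continuous_interval)
      ultimately have "\<bar>f a * d - integral {a..b} f\<bar> \<le> d * (e / (2 * t))"
        using ab by (simp add: mult.commute abs_minus_commute)
      moreover have "\<bar>(\<Sum>j<k. f (real j * d) * d) - integral {0..a} f\<bar> \<le> real k * d * (e / (2 * t))"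
        using Suc by (simp add: a_def)
      moreover have "real (Suc k) * d * (e / (2 * t)) = real k * d * (e / (2 * t)) + d * (e / (2 * t))"
        by (simp only: of_nat_Suc distrib_right mult_1 add.commute)
      moreover have "(\<Sum>j<Suc k. f (real j * d) * d) = (\<Sum>j<k. f (real j * d) * d) + f a * d"
        by (simp add: a_def)
      ultimately show ?case unfolding b_def[symmetric] split[symmetric] by linarith
    qed
    have "\<bar>(\<Sum>j<Suc N. f (real j * d) * d) - integral {0..t} f\<bar> \<le> t * (e / (2 * t))"
      using part[of "Suc N"] unfolding dt by simp
    also have "\<dots> < e" using t e by simp
    finally show "norm ((\<Sum>j<Suc N. f (real j * (t / real (Suc N))) * (t / real (Suc N)))
      - integral {0..t} f) < e" unfolding d_def real_norm_def .
  qed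
qed

text \<open>A connected set that meets \<open>\<Omega>\<close> and its complement meets the frontier, so a continuous
  path cannot leave \<open>\<Omega>\<close> without being killed.\<close>

lemma alive_imp_in_domain:
  assumes "alive \<Omega> \<omega> t" "continuous_on {0..t} \<omega>" "\<omega> 0 \<in> \<Omega>" "s \<in> {0..t}"
  shows "\<omega> s \<in> \<Omega>"
proof (rule ccontr)
  assume "\<omega> s \<notin> \<Omega>"
  have "connected (\<omega> ` {0..t})" by (intro connected_continuous_image assms(2)) simp
  moreover have "\<omega> 0 \<in> \<omega> ` {0..t}" using assms(4) by (intro imageI) auto
  then have "\<omega> ` {0..t} \<inter> \<Omega> \<noteq> {}" using assms(3) by blast
  moreover have "\<omega> ` {0..t} - \<Omega> \<noteq> {}" using imageI[OF assms(4), of \<omega>] \<open>\<omega> s \<notin> \<Omega>\<close> by blast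
  ultimately have "\<omega> ` {0..t} \<inter> frontier \<Omega> \<noteq> {}" by (rule connected_Int_frontier)
  then show False using assms(1) by (auto simp: alive_def)
qed

definition killed_weight :: "(real ^ 'n) set \<Rightarrow> (real ^ 'n \<Rightarrow> real) \<Rightarrow> real \<Rightarrow> real ^ 'n \<Rightarrow> ennreal" where
  "killed_weight K c d y = ennreal (if y \<in> K then exp (c y * d) else 0)"

text \<open>The complement of \<open>K\<close> is open, so a path outside \<open>K\<close> at time \<open>s\<close> is outside it during a
  whole time interval around \<open>s\<close>, which a fine grid cannot jump over.\<close>

lemma exit_seen_on_fine_grids:
  fixes \<omega> :: "real \<Rightarrow> 'a::metric_space"
  assumes t: "0 < t" and K: "closed K" and \<omega>: "continuous_on {0..t} \<omega>"
    and s: "s \<in> {0..t}" "\<omega> s \<notin> K"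
  shows "\<forall>\<^sub>F N in sequentially. \<exists>j\<le>Suc N. \<omega> (real j * (t / real (Suc N))) \<notin> K"
proof -
  have "open (- K)" using K by auto
  then obtain r where r: "0 < r" "ball (\<omega> s) r \<subseteq> - K"
    using s(2) by (meson ComplI openE)
  obtain \<delta> where \<delta>: "0 < \<delta>" "\<And>s'. s' \<in> {0..t} \<Longrightarrow> dist s' s < \<delta> \<Longrightarrow> dist (\<omega> s') (\<omega> s) < r"
    using \<omega> s(1) r(1) unfolding continuous_on_iff by meson
  obtain m :: nat where m: "t / \<delta> < real m" using reals_Archimedean2 by blast
  show ?thesis
  proof (rule eventually_sequentiallyI[of m])
    fix N assume "m \<le> N"
    define d where "d = t / real (Suc N)"
    have d: "0 < d" using t by (simp add: d_def)
    have "t / \<delta> < real (Suc N)" using m \<open>m \<le> N\<close> by linarith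
    then have dd: "d < \<delta>" using \<delta>(1) by (simp add: d_def field_simps)
    define j where "j = nat \<lfloor>s / d\<rfloor>"
    have "0 \<le> s / d" using s(1) d by simp
    then have j: "real j \<le> s / d" "s / d < real j + 1" by (auto simp: j_def)
    then have js: "real j * d \<le> s" "s < real j * d + d" using d by (auto simp: field_simps)
    have "s / d \<le> t / d" using s(1) d by (intro divide_right_mono) auto
    also have "\<dots> = real (Suc N)" using t by (simp add: d_def)
    finally have "s / d \<le> real (Suc N)" .
    then have "j \<le> Suc N" using j(1) by linarith
    moreover have "dist (\<omega> (real j * d)) (\<omega> s) < r"
      using js d s(1) dd by (intro \<delta>(2)) (auto simp: dist_real_def)
    then have "\<omega> (real j * d) \<notin> K" using r(2) by (auto simp: dist_commute subset_iff)
    ultimately show "\<exists>j\<le>Suc N. \<omega> (real j * (t / real (Suc N))) \<notin> K"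
      unfolding d_def by blast
  qed
qed

text \<open>If the path stays in \<open>K\<close>, the exponents are Riemann sums and the bound is attained as a
  limit; if it leaves \<open>K\<close>, some grid point lies outside for all fine grids and the product is
  zero. The endpoint \<open>\<omega> t\<close> is not among the factors of the product, so it needs its own
  indicator.\<close>

lemma limsup_grid_weights_le:
  fixes \<omega> :: "real \<Rightarrow> real ^ 'n" and c g :: "real ^ 'n \<Rightarrow> real"
  assumes t: "0 < t" and K: "closed K" and c: "continuous_on K c" and \<omega>: "continuous_on {0..t} \<omega>"
  shows "limsup (\<lambda>N. (\<Prod>j<Suc N. killed_weight K c (t / real (Suc N)) (\<omega> (real j * (t / real (Suc N))))) *
            (indicator K (\<omega> t) * ennreal \<bar>g (\<omega> t)\<bar>))
     \<le> (if \<forall>s\<in>{0..t}. \<omega> s \<in> K then ennreal (\<bar>g (\<omega> t)\<bar> * exp (integral {0..t} (\<lambda>s. c (\<omega> s)))) else 0)"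
    (is "limsup ?F \<le> ?R")
proof (cases "\<forall>s\<in>{0..t}. \<omega> s \<in> K")
  case True
  have eq: "?F N = ennreal (\<bar>g (\<omega> t)\<bar> *
      exp (\<Sum>j<Suc N. c (\<omega> (real j * (t / real (Suc N)))) * (t / real (Suc N))))" for N
  proof -
    have grid: "real j * (t / real (Suc N)) \<in> {0..t}" if "j < Suc N" for j
    proof -
      have "real j * (t / real (Suc N)) \<le> real (Suc N) * (t / real (Suc N))"
        using that t by (intro mult_right_mono) auto
      then show ?thesis using t by simp
    qed
    have "(\<Prod>j<Suc N. killed_weight K c (t / real (Suc N)) (\<omega> (real j * (t / real (Suc N)))))
        = (\<Prod>j<Suc N. ennreal (exp (c (\<omega> (real j * (t / real (Suc N)))) * (t / real (Suc N)))))"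
      using True grid by (intro prod.cong) (auto simp: killed_weight_def)
    also have "\<dots> = ennreal (exp (\<Sum>j<Suc N. c (\<omega> (real j * (t / real (Suc N)))) * (t / real (Suc N))))"
      by (subst prod_ennreal) (simp_all only: exp_sum finite_lessThan exp_ge_zero)
    finally show ?thesis using True t by (simp add: ennreal_mult' mult.commute)
  qed
  have "continuous_on {0..t} (\<lambda>s. c (\<omega> s))"
    using True by (intro continuous_on_compose2[OF c \<omega>]) auto
  from left_riemann_sums_tendsto_integral[OF t this]
  have "?F \<longlonglongrightarrow> ennreal (\<bar>g (\<omega> t)\<bar> * exp (integral {0..t} (\<lambda>s. c (\<omega> s))))"
    unfolding eq by (intro tendsto_ennrealI tendsto_mult tendsto_const tendsto_exp)
  from lim_imp_Limsup[OF _ this] show ?thesis using True by simp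
next
  case False
  then obtain s where s: "s \<in> {0..t}" "\<omega> s \<notin> K" by auto
  have "\<forall>\<^sub>F N in sequentially. ?F N \<le> 0"
    using exit_seen_on_fine_grids[OF t K \<omega> s]
  proof eventually_elim
    case (elim N)
    then obtain j where j: "j \<le> Suc N" "\<omega> (real j * (t / real (Suc N))) \<notin> K" by auto
    show ?case
    proof (cases "j = Suc N")
      case True
      then show ?thesis using j(2) by simp
    next
      case False
      then have "(\<Prod>j<Suc N. killed_weight K c (t / real (Suc N)) (\<omega> (real j * (t / real (Suc N))))) = 0"
        using j by (intro prod_zero bexI[of _ j]) (auto simp: killed_weight_def)
      then show ?thesis by simp
    qed
  qed
  then have "limsup ?F \<le> 0" by (rule Limsup_bounded)
  then show ?thesis by (simp only: False if_False)
qed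

section \<open>The Feynman--Kac inequality and its consequence\<close>

context standard_brownian_motion
begin

lemma measurable_bm_path: "0 \<le> s \<Longrightarrow> (\<lambda>w. bm_path W x w s) \<in> borel_measurable M"
  unfolding bm_path_def by (intro borel_measurable_add borel_measurable_scaleR borel_measurable_const measurable_W)

lemma continuous_bm_path: "w \<in> space M \<Longrightarrow> continuous_on {0..t} (bm_path W x w)"
  unfolding bm_path_def[abs_def]
  by (intro continuous_intros continuous_on_subset[OF continuous_paths]) auto

lemma bm_path_0: "w \<in> space M \<Longrightarrow> bm_path W x w 0 = x"
  by (simp add: bm_path_def start_zero)

text \<open>The Feynman--Kac inequality for the eigenfunction. It suffices to prove it up to an error \<open>e\<close>,
  which is split evenly between the level \<open>eps\<close> that defines \<open>K\<close> and the accumulated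
  discretization errors.\<close>

lemma abs_le_killed_path_integral:
  fixes \<Omega> :: "(real ^ 'n) set"
  assumes bdd: "bounded \<Omega>" and op: "open \<Omega>" and Vc: "continuous_on \<Omega> V" and V0: "\<And>x. x \<in> \<Omega> \<Longrightarrow> 0 \<le> V x"
    and sol: "dirichlet_solution \<Omega> V lam \<phi>" and x: "x \<in> \<Omega>" and t: "0 < t"
  shows "ennreal \<bar>\<phi> x\<bar> \<le> (\<integral>\<^sup>+ w. (if alive \<Omega> (bm_path W x w) t then
      ennreal (\<bar>\<phi> (bm_path W x w t)\<bar> * exp (lam * t - integral {0..t} (\<lambda>s. V (bm_path W x w s)))) else 0) \<partial>M)"
    (is "_ \<le> ?I")
proof (rule ennreal_le_epsilon)
  fix e :: real assume e: "0 < e"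
  have C2: "Ck_on 2 \<phi> \<Omega>" and cont: "continuous_on (closure \<Omega>) \<phi>"
    and pde: "\<And>x. x \<in> \<Omega> \<Longrightarrow> - laplacian \<phi> x + V x * \<phi> x = lam * \<phi> x"
    and bc: "\<And>x. x \<in> frontier \<Omega> \<Longrightarrow> \<phi> x = 0"
    using sol by (auto simp: dirichlet_solution_def)
  \<comment> \<open>Gaussian steps may leave \<open>\<Omega>\<close>, so \<open>\<phi>\<close> is cut off outside.\<close>
  define g where "g = (\<lambda>y. if y \<in> \<Omega> then \<phi> y else 0)"
  have g_eq: "y \<in> \<Omega> \<Longrightarrow> g y = \<phi> y" for y by (simp add: g_def)
  have gm [measurable]: "g \<in> borel_measurable borel"
    unfolding g_def using op
    by (intro borel_measurable_continuous_on_if continuous_on_const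
        continuous_on_subset[OF cont closure_subset]) auto
  have "bounded (\<phi> ` closure \<Omega>)"
    using bdd by (intro compact_imp_bounded compact_continuous_image cont) (simp add: compact_closure)
  then obtain B where B: "0 < B" "\<And>y. y \<in> closure \<Omega> \<Longrightarrow> \<bar>\<phi> y\<bar> \<le> B"
    unfolding bounded_pos by auto
  have gB: "\<bar>g y\<bar> \<le> B" for y
    using B closure_subset[of \<Omega>] by (auto simp: g_def)
  define L where "L = exp (\<bar>lam\<bar> * t)"
  \<comment> \<open>The factor \<open>L\<close> bounds the weight collected by a path over the whole time span, so the final
     error \<open>L * (eps + t * eta)\<close> equals \<open>e\<close>.\<close>
  define eps where "eps = e / (2 * L)"
  define eta where "eta = e / (2 * L * t)"
  have L: "0 < L" by (simp add: L_def)
  have eps: "0 < eps" and eta: "0 < eta" using e L t by (simp_all add: eps_def eta_def)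
  define K where "K = {y \<in> closure \<Omega>. eps \<le> \<bar>\<phi> y\<bar>}"
  have K_closed: "closed K"
    unfolding K_def by (intro continuous_on_closed_Collect_le continuous_intros cont) simp
  have "bounded K" using bdd by (rule bounded_subset[OF bounded_closure]) (auto simp: K_def)
  then have K: "compact K" using K_closed by (simp add: compact_eq_bounded_closed)
  have K\<Omega>: "K \<subseteq> \<Omega>"
  proof
    fix y assume y: "y \<in> K"
    show "y \<in> \<Omega>"
    proof (rule ccontr)
      assume "y \<notin> \<Omega>"
      then have "y \<in> frontier \<Omega>" using y op by (simp add: K_def frontier_def interior_open)
      then show False using bc[of y] y eps by (simp add: K_def)
    qed
  qed
  define c where "c = (\<lambda>y. lam - V y)"
  have c_cont: "continuous_on K c"
    unfolding c_def by (intro continuous_intros continuous_on_subset[OF Vc K\<Omega>])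
  have c_le: "c y \<le> \<bar>lam\<bar>" if "y \<in> K" for y
    using V0[of y] that K\<Omega> by (auto simp: c_def)
  have q_meas: "killed_weight K c d \<in> borel_measurable borel" for d
  proof -
    have "(\<lambda>y. if y \<in> K then exp (c y * d) else 0) \<in> borel_measurable borel"
      using K_closed by (intro borel_measurable_continuous_on_if continuous_intros c_cont) auto
    then show ?thesis unfolding killed_weight_def[abs_def] by measurable
  qed
  have q_le: "killed_weight K c d y \<le> ennreal (exp (\<bar>lam\<bar> * d))" if "0 < d" for d y
    using c_le[of y] that by (auto simp: killed_weight_def intro!: ennreal_leI)
  define u where "u = (\<lambda>y. ennreal \<bar>g y\<bar>)"
  have u_meas [measurable]: "u \<in> borel_measurable borel" unfolding u_def by measurable
  have Ku_meas: "(\<lambda>y. indicator K y * u y) \<in> borel_measurable borel"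
    by (intro borel_measurable_times_ennreal u_meas borel_measurable_indicator borel_closed K_closed)
  define F where "F = (\<lambda>N w. (\<Prod>j<Suc N. killed_weight K c (t / real (Suc N)) (bm_path W x w (real j * (t / real (Suc N))))) *
            (indicator K (bm_path W x w t) * ennreal \<bar>g (bm_path W x w t)\<bar>))"
  have F_int: "integral\<^sup>N M (F N) =
      (weighted_step (t / real (Suc N)) (killed_weight K c (t / real (Suc N))) ^^ Suc N) (\<lambda>y. indicator K y * u y) x" for N
    using nn_integral_bm_grid[where d = "t / real (Suc N)" and q = "killed_weight K c (t / real (Suc N))"
        and f = "\<lambda>y. indicator K y * u y" and N = "Suc N" and x = x]
      q_meas Ku_meas t by (simp add: F_def u_def del: prod.lessThan_Suc funpow.simps)
  obtain d0 where d0: "0 < d0" "\<And>d y. 0 < d \<Longrightarrow> d \<le> d0 \<Longrightarrow> y \<in> K \<Longrightarrow>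
    \<bar>\<phi> y\<bar> \<le> exp ((lam - V y) * d) * (\<integral>z. \<bar>g (y + sqrt 2 *\<^sub>R z)\<bar> \<partial>gauss d) + eta * d"
    using one_step_estimate[OF op K K\<Omega> C2 Vc pde g_eq gB gm eta] by blast
  obtain m :: nat where m: "t / d0 < real m" using reals_Archimedean2 by blast
  have fine: "ennreal \<bar>\<phi> x\<bar> \<le> integral\<^sup>N M (F N) + ennreal e" if "m \<le> N" for N
  proof -
    define d where "d = t / real (Suc N)"
    have d: "0 < d" using t by (simp add: d_def)
    have "t / d0 < real (Suc N)" using m that by linarith
    then have dd: "d \<le> d0" using d0(1) by (simp add: d_def field_simps)
    have dt: "real (Suc N) * d = t" by (simp add: d_def)
    interpret gauss: prob_space "gauss d :: (real^'n) measure" by (rule prob_space_gauss[OF d])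
    have inside: "u y \<le> weighted_step d (killed_weight K c d) u y + ennreal (eta * d)" if "y \<in> K" for y
    proof -
      have "integrable (gauss d) (\<lambda>z. \<bar>g (y + sqrt 2 *\<^sub>R z)\<bar>)"
        by (rule gauss.integrable_const_bound[of _ B]) (auto simp: gB)
      then have int: "(\<integral>\<^sup>+ z. u (y + sqrt 2 *\<^sub>R z) \<partial>gauss d) = ennreal (\<integral>z. \<bar>g (y + sqrt 2 *\<^sub>R z)\<bar> \<partial>gauss d)"
        unfolding u_def by (rule nn_integral_eq_integral) simp
      have "u y = ennreal \<bar>\<phi> y\<bar>" using that K\<Omega> by (simp add: u_def g_eq subset_iff)
      also have "\<dots> \<le> ennreal (exp ((lam - V y) * d) * (\<integral>z. \<bar>g (y + sqrt 2 *\<^sub>R z)\<bar> \<partial>gauss d) + eta * d)"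
        by (intro ennreal_leI d0(2) d dd that)
      also have "\<dots> = weighted_step d (killed_weight K c d) u y + ennreal (eta * d)"
        using that eta d by (simp add: weighted_step_def int killed_weight_def c_def ennreal_mult)
      finally show ?thesis .
    qed
    have outside: "u y \<le> ennreal eps" if "y \<notin> K" for y
      using that eps closure_subset[of \<Omega>] by (auto simp: u_def g_def K_def intro!: ennreal_leI)
    have "u x \<le> (weighted_step d (killed_weight K c d) ^^ Suc N) (\<lambda>y. indicator K y * u y) x
        + ennreal (exp (\<bar>lam\<bar> * d) ^ Suc N * (eps + real (Suc N) * (eta * d)))"
      using eta eps d K_closed
      by (intro le_weighted_step_iterate d q_meas u_meas q_le inside outside) auto
    moreover have "exp (\<bar>lam\<bar> * d) ^ Suc N * (eps + real (Suc N) * (eta * d)) = e"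
    proof -
      have "exp (\<bar>lam\<bar> * d) ^ Suc N = exp (real (Suc N) * (\<bar>lam\<bar> * d))"
        by (rule exp_of_nat_mult[symmetric])
      also have "real (Suc N) * (\<bar>lam\<bar> * d) = \<bar>lam\<bar> * t" using dt by (simp only: mult.left_commute)
      finally have 1: "exp (\<bar>lam\<bar> * d) ^ Suc N = L" by (simp add: L_def)
      have 2: "real (Suc N) * (eta * d) = eta * t" using dt by (simp only: mult.left_commute)
      show ?thesis unfolding 1 2 using L t by (simp add: eps_def eta_def field_simps)
    qed
    moreover have "u x = ennreal \<bar>\<phi> x\<bar>" using x by (simp add: u_def g_eq)
    ultimately show ?thesis by (simp only: F_int d_def)
  qed
  have F_meas: "F N \<in> borel_measurable M" for N
    unfolding F_def
    by (intro borel_measurable_times_ennreal borel_measurable_prod_ennreal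
        measurable_compose[OF measurable_bm_path q_meas]
        measurable_compose[OF measurable_bm_path Ku_meas[unfolded u_def]]) (use t in auto)
  have F_le: "F N w \<le> ennreal (L * B)" for N w
  proof -
    define d where "d = t / real (Suc N)"
    have d: "0 < d" using t by (simp add: d_def)
    have "(\<Prod>j<Suc N. killed_weight K c d (bm_path W x w (real j * d)))
        = ennreal (\<Prod>j<Suc N. if bm_path W x w (real j * d) \<in> K then exp (c (bm_path W x w (real j * d)) * d) else 0)"
      unfolding killed_weight_def by (intro prod_ennreal) auto
    also have "\<dots> \<le> ennreal (\<Prod>j<Suc N. exp (\<bar>lam\<bar> * d))"
      using c_le d by (intro ennreal_leI prod_mono) auto
    also have "(\<Prod>j<Suc N. exp (\<bar>lam\<bar> * d)) = L"
    proof -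
      have "(\<Prod>j<Suc N. exp (\<bar>lam\<bar> * d)) = exp (real (Suc N) * (\<bar>lam\<bar> * d))"
        by (simp only: prod_constant card_lessThan exp_of_nat_mult)
      also have "real (Suc N) * (\<bar>lam\<bar> * d) = \<bar>lam\<bar> * t" by (simp add: d_def)
      finally show ?thesis by (simp add: L_def)
    qed
    finally have 1: "(\<Prod>j<Suc N. killed_weight K c d (bm_path W x w (real j * d))) \<le> ennreal L" .
    have 2: "indicator K (bm_path W x w t) * ennreal \<bar>g (bm_path W x w t)\<bar> \<le> ennreal B"
      using gB by (auto simp: indicator_def intro!: ennreal_leI)
    have "F N w \<le> ennreal L * ennreal B"
      unfolding F_def d_def[symmetric] by (intro mult_mono 1 2) auto
    then show ?thesis using L B by (simp add: ennreal_mult)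
  qed
  have "ennreal \<bar>\<phi> x\<bar> - ennreal e \<le> limsup (\<lambda>N. integral\<^sup>N M (F N))"
  proof (rule le_Limsup)
    show "\<forall>\<^sub>F N in sequentially. ennreal \<bar>\<phi> x\<bar> - ennreal e \<le> integral\<^sup>N M (F N)"
      using fine by (intro eventually_sequentiallyI[of m]) (simp add: ennreal_minus_le_iff add.commute)
  qed simp
  also have "\<dots> \<le> (\<integral>\<^sup>+ w. limsup (\<lambda>N. F N w) \<partial>M)"
    by (rule nn_integral_limsup[where w = "\<lambda>_. ennreal (L * B)"])
       (use F_meas F_le emeasure_space_1 in \<open>auto simp: ennreal_mult_less_top\<close>)
  also have "\<dots> \<le> ?I"
  proof (rule nn_integral_mono)
    fix w assume w: "w \<in> space M"
    define \<omega> where "\<omega> = bm_path W x w"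
    have \<omega>: "continuous_on {0..t} \<omega>" unfolding \<omega>_def by (rule continuous_bm_path[OF w])
    have "limsup (\<lambda>N. F N w) \<le> (if \<forall>s\<in>{0..t}. \<omega> s \<in> K then
        ennreal (\<bar>g (\<omega> t)\<bar> * exp (integral {0..t} (\<lambda>s. c (\<omega> s)))) else 0)"
      unfolding F_def \<omega>_def[symmetric] by (rule limsup_grid_weights_le[OF t K_closed c_cont \<omega>])
    also have "\<dots> \<le> (if alive \<Omega> \<omega> t then
        ennreal (\<bar>\<phi> (\<omega> t)\<bar> * exp (lam * t - integral {0..t} (\<lambda>s. V (\<omega> s)))) else 0)"
    proof (cases "\<forall>s\<in>{0..t}. \<omega> s \<in> K")
      case True
      then have in\<Omega>: "\<And>s. s \<in> {0..t} \<Longrightarrow> \<omega> s \<in> \<Omega>" using K\<Omega> by auto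
      then have "alive \<Omega> \<omega> t"
        using op by (auto simp: alive_def frontier_def interior_open)
      moreover have "g (\<omega> t) = \<phi> (\<omega> t)" using in\<Omega>[of t] t by (simp add: g_eq)
      moreover have "integral {0..t} (\<lambda>s. c (\<omega> s)) = lam * t - integral {0..t} (\<lambda>s. V (\<omega> s))"
      proof -
        have "continuous_on {0..t} (\<lambda>s. V (\<omega> s))"
          using in\<Omega> by (intro continuous_on_compose2[OF Vc \<omega>]) auto
        then show ?thesis unfolding c_def using t
          by (subst integral_diff) (auto intro: integrable_continuous_interval)
      qed
      ultimately show ?thesis by simp
    next
      case False
      then show ?thesis by (simp only: if_False zero_le)
    qed
    finally show "limsup (\<lambda>N. F N w) \<le> (if alive \<Omega> (bm_path W x w) t then
      ennreal (\<bar>\<phi> (bm_path W x w t)\<bar> * exp (lam * t - integral {0..t} (\<lambda>s. V (bm_path W x w s)))) else 0)"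
      unfolding \<omega>_def .
  qed
  finally show "ennreal \<bar>\<phi> x\<bar> \<le> ?I + ennreal e"
    by (simp add: ennreal_minus_le_iff add.commute)
qed

end

theorem theorem2:
  fixes \<Omega> :: "(real ^ 'n) set"
    and V \<phi> h :: "real ^ 'n \<Rightarrow> real"
    and lam :: real
    and M :: "'w measure"
    and W :: "real \<Rightarrow> 'w \<Rightarrow> real ^ 'n"
  assumes "bounded \<Omega>" and "open \<Omega>" and "smooth_boundary \<Omega>"
    and "Ck_on 2 V \<Omega>" and "\<forall>x\<in>\<Omega>. V x \<ge> 0"
    and "dirichlet_solution \<Omega> V lam \<phi>"
    and "\<exists>x\<in>\<Omega>. \<phi> x \<noteq> 0"
    and "h \<in> borel_measurable (lebesgue_on \<Omega>)"
    and "\<forall>x\<in>\<Omega>. \<bar>\<phi> x\<bar> \<le> h x * sup_norm \<Omega> \<phi>"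
    and "standard_brownian_motion M W"
  shows "(\<forall>x\<in>\<Omega>. ennreal \<bar>\<phi> x\<bar> \<le> h1 M W \<Omega> V lam h x * ennreal (sup_norm \<Omega> \<phi>)) \<and>
    (\<forall>x\<in>\<Omega>. h1 M W \<Omega> V lam h x =
           (INF t\<in>{0..}. ennreal (exp (lam * t)) * schroedinger_semigroup M W \<Omega> V t h x))"
proof (intro conjI ballI)
  fix x assume x: "x \<in> \<Omega>"
  interpret standard_brownian_motion M W by fact
  define S where "S = sup_norm \<Omega> \<phi>"
  have S: "0 < S"
  proof -
    have "bounded (\<phi> ` closure \<Omega>)"
      using assms(1,6) by (intro compact_imp_bounded compact_continuous_image)
        (auto simp: compact_closure dirichlet_solution_def)
    then have "bdd_above ((\<lambda>x. \<bar>\<phi> x\<bar>) ` \<Omega>)"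
      using closure_subset[of \<Omega>] unfolding bounded_iff bdd_above_def by fastforce
    moreover obtain x0 where "x0 \<in> \<Omega>" "\<phi> x0 \<noteq> 0" using assms(7) by auto
    ultimately have "\<bar>\<phi> x0\<bar> \<le> S" unfolding S_def sup_norm_def by (intro cSUP_upper)
    then show ?thesis using \<open>\<phi> x0 \<noteq> 0\<close> by simp
  qed
  define P where "P = (\<lambda>t. killed_expectation M W \<Omega> t x
        (\<lambda>\<omega>. h (\<omega> t) * exp (lam * t - integral {0..t} (\<lambda>s. V (\<omega> s)))))"
  have Vc: "continuous_on \<Omega> V"
    using assms(4) by (auto simp: numeral_2_eq_2 intro!: continuous_at_imp_continuous_on
        differentiable_imp_continuous_within)
  have P: "ennreal \<bar>\<phi> x\<bar> \<le> ennreal S * P t" if "0 \<le> t" for t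
  proof -
    have "ennreal \<bar>\<phi> x\<bar> \<le> (\<integral>\<^sup>+ w. (if alive \<Omega> (bm_path W x w) t then
      ennreal (\<bar>\<phi> (bm_path W x w t)\<bar> * exp (lam * t - integral {0..t} (\<lambda>s. V (bm_path W x w s)))) else 0) \<partial>M)"
      (is "_ \<le> integral\<^sup>N M ?f")
    proof (cases "t = 0")
      case True
      have "x \<notin> frontier \<Omega>" using x assms(2) by (simp add: frontier_def interior_open)
      then have "integral\<^sup>N M ?f = (\<integral>\<^sup>+ w. ennreal \<bar>\<phi> x\<bar> \<partial>M)"
        using True by (intro nn_integral_cong) (simp add: alive_def bm_path_0)
      then show ?thesis using emeasure_space_1 by simp
    next
      case False
      then show ?thesis
        using assms(1,2,5,6) Vc x that by (intro abs_le_killed_path_integral) auto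
    qed
    also have "\<dots> \<le> (\<integral>\<^sup>+ w. ennreal S * (if alive \<Omega> (bm_path W x w) t then
      ennreal (h (bm_path W x w t) * exp (lam * t - integral {0..t} (\<lambda>s. V (bm_path W x w s)))) else 0) \<partial>M)"
    proof (rule nn_integral_mono)
      fix w assume w: "w \<in> space M"
      define E where "E = exp (lam * t - integral {0..t} (\<lambda>s. V (bm_path W x w s)))"
      have "\<bar>\<phi> (bm_path W x w t)\<bar> * E \<le> S * (h (bm_path W x w t) * E)" if "alive \<Omega> (bm_path W x w) t"
      proof -
        have "bm_path W x w t \<in> \<Omega>"
          using alive_imp_in_domain[OF that continuous_bm_path[OF w], of t] bm_path_0[OF w] x \<open>0 \<le> t\<close>
          by simp
        then have "\<bar>\<phi> (bm_path W x w t)\<bar> * E \<le> h (bm_path W x w t) * S * E"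
          using assms(9) by (intro mult_right_mono) (auto simp: S_def E_def)
        then show ?thesis by (simp add: mult_ac)
      qed
      then show "?f w \<le> ennreal S * (if alive \<Omega> (bm_path W x w) t then
        ennreal (h (bm_path W x w t) * exp (lam * t - integral {0..t} (\<lambda>s. V (bm_path W x w s)))) else 0)"
        using S unfolding E_def[symmetric] by (auto simp: ennreal_mult'[symmetric] intro!: ennreal_leI)
    qed
    also have "\<dots> = ennreal S * P t"
      unfolding P_def killed_expectation_def by (rule nn_integral_scale[OF S])
    finally show ?thesis .
  qed
  have "ennreal (\<bar>\<phi> x\<bar> / S) \<le> h1 M W \<Omega> V lam h x"
    unfolding h1_def P_def[symmetric]
  proof (rule INF_greatest)
    fix t :: real assume "t \<in> {0..}"
    then have "ennreal S * ennreal (\<bar>\<phi> x\<bar> / S) \<le> ennreal S * P t"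
      using P[of t] S by (simp add: ennreal_mult[symmetric])
    then show "ennreal (\<bar>\<phi> x\<bar> / S) \<le> P t"
      using S by (subst (asm) ennreal_mult_le_mult_iff) auto
  qed
  then have "ennreal (\<bar>\<phi> x\<bar> / S) * ennreal S \<le> h1 M W \<Omega> V lam h x * ennreal S"
    by (rule mult_right_mono) simp
  then show "ennreal \<bar>\<phi> x\<bar> \<le> h1 M W \<Omega> V lam h x * ennreal (sup_norm \<Omega> \<phi>)"
    using S by (simp add: ennreal_mult[symmetric] S_def)
next
  fix x assume "x \<in> \<Omega>"
  have "killed_expectation M W \<Omega> t x (\<lambda>\<omega>. h (\<omega> t) * exp (lam * t - integral {0..t} (\<lambda>s. V (\<omega> s))))
      = ennreal (exp (lam * t)) * schroedinger_semigroup M W \<Omega> V t h x" for t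
    unfolding schroedinger_semigroup_def killed_expectation_def
    by (subst nn_integral_scale[symmetric])
       (auto intro!: nn_integral_cong simp: ennreal_mult'[symmetric] exp_diff exp_minus field_simps)
  then show "h1 M W \<Omega> V lam h x =
      (INF t\<in>{0..}. ennreal (exp (lam * t)) * schroedinger_semigroup M W \<Omega> V t h x)"
    by (simp add: h1_def)
qed

end
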